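(* Let $\dim E=n-1\equiv2\pmod8$. Every zero charge superization $\mathfrak g=\mathfrak{heis}_b+S$ of the Heisenberg algebra $\mathfrak{heis}_b=E^*+E+\mathbb R\mathrm p$ with $[S,S]=\mathbb R\mathrm p$ is such that $$\mathrm p_{--}=\mathrm p_{-+}=0,\qquad \mathrm p_{++}\neq0,\qquad (\rho_{11},\rho_{12})\ \text{is a suitable pair},$$ and either $\rho_{11}=0$, or $$0\neq\rho_{11}\in\mathrm{Hom}_{\mathbb R}(E,J\mathbb R)\quad\text{and}\quad\mathrm p_{++}\in\mathrm{Bil}_{\mathbb R}(S_{0,n-1})^J,$$ where $\mathrm{Bil}_{\mathbb R}(S_{0,n-1})^J$ is the space of $J$-hermitian bilinear forms on $S_{0,n-1}$.
   Context: $E=\mathbb R^{0,n-1}$ is an $(n-1)$-dimensional real vector space with a negative definite inner product $\langle\cdot,\cdot\rangle$; $e^\flat=\langle e,\cdot\rangle\in E^*$. $b$ is a non-degenerate symmetric bilinear form on $E$ and $B\in\mathrm{End}_{\mathbb R}(E)$ is defined by $b(\cdot,\cdot)=-\langle B\cdot,\cdot\rangle$. The Heisenberg algebra $\mathfrak{heis}_b=E^*+E+\mathbb R\mathrm p$ has as only non-trivial brackets $[e^\flat,f]=b(e,f)\mathrm p$ ($e,f\in E$). $\mathrm{Cl}_{0,n-1}$ is the Clifford algebra of $E$ with convention $v^2=-\langle v,v\rangle$, $S_{0,n-1}$ a real irreducible $\mathrm{Cl}_{0,n-1}$-module, on which vectors of $E$ act by Clifford multiplication; $\mathfrak{so}(E)\hookrightarrow\mathrm{Cl}_{0,n-1}$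 via $v\wedge w\mapsto\frac14[v,w]$. For $n-1\equiv2\pmod8$, the Schur algebra $\mathcal C_{0,n-1}=\mathrm{End}_{\mathbb R}(S_{0,n-1})^{\mathfrak{so}(E)}$ is $\mathbb R\,\mathrm{Id}+\mathbb RJ\cong\mathbb C$, where $J$ is the complex structure given by the action of the volume form $e_1\cdots e_{n-1}$ ($e_i$ an orthonormal basis); $J$ anticommutes with Clifford multiplication by vectors. The map $C\mapsto\overline C$ on $\mathcal C_{0,n-1}$ is linear with $\overline{\mathrm{Id}}=\mathrm{Id}$, $\overline J=-J$. A bilinear form $\Gamma$ on $S_{0,n-1}$ is $J$-hermitian if $\Gamma(Js,Jt)=\Gamma(s,t)$. Let $\mathfrak m=E+\mathbb R\mathrm p+\mathbb R\mathrm q$ be Minkowski space ($\mathrm p,\mathrm q$ isotropic, orthogonal to $E$, $\langle\mathrm p,\mathrm q\rangle=1$) and $S=S_{1,n}$ the real irreducible $\mathrm{Cl}(\mathfrak m)$-module, identified as a vector space with $S=S_-+S_+=S_{0,n-1}+S_{0,n-1}$ (endomorphisms written as $2\times2$ block matrices) in such a way that $\mathrm p\wedge e\in\mathfrak{so}(\mathfrak m)$ acts as $\begin{pmatrix}0&\sqrt2\,e\\0&0\end{pmatrix}$. A representation $\rho:\mathfrak{heis}_b\to\mathfrak{gl}_{\mathbb R}(S)$ is spin if $\rho(e^\flat)=\begin{pmatrix}0&\sqrt2\,Be\\0&0\end{pmatrix}$ for all $e\in E$; it has zero charge if $\rho(\mathrm p)=0$. Zero charge spin representations have the form $\rho(e)=\begin{pmatrix}\rho_{11}(e)&\rho_{12}(e)\\0&\overline{\rho_{11}(e)}\end{pmatrix}$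 for $e\in E$, with $\rho_{11}\in\mathrm{Hom}_{\mathbb R}(E,\mathcal C_{0,n-1})$ and $\rho_{12}\in\mathrm{Hom}_{\mathbb R}(E,\mathrm{End}_{\mathbb R}(S_{0,n-1}))$; this defines $\rho_{11},\rho_{12}$. The pair $(\rho_{11},\rho_{12})$ is suitable if $[\rho_{11}(E),\rho_{11}(E)]=0$ and $e\otimes f\mapsto\rho_{11}(e)\circ\rho_{12}(f)-\rho_{12}(f)\circ\overline{\rho_{11}(e)}$ is symmetric in $e,f\in E$. A superization of $\mathfrak{heis}_b$ is a Lie superalgebra $\mathfrak g=\mathfrak g_{\bar0}+\mathfrak g_{\bar1}$ with $\mathfrak g_{\bar0}=\mathfrak{heis}_b$, $\mathfrak g_{\bar1}=S$, such that the adjoint action $\rho$ of $\mathfrak g_{\bar0}$ on $\mathfrak g_{\bar1}$ is a spin representation; it is zero charge if $\rho$ is. The symmetric bilinear form $\mathrm p(\cdot,\cdot)$ on $S$ is defined by $[Q,\tilde Q]=\mathrm p(Q,\tilde Q)\,\mathrm p$, and $\mathrm p_{--}:S_-\vee S_-\to\mathbb R$, $\mathrm p_{-+}:S_-\otimes S_+\to\mathbb R$, $\mathrm p_{++}:S_+\vee S_+\to\mathbb R$ denote its restrictions ($S_\mp$ identified with $S_{0,n-1}$). *)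

theory Defs
  imports "HOL-Analysis.Analysis"
begin

section \<open>The negative definite space and Clifford modules\<close>

definition neg_inner :: "'a::euclidean_space \<Rightarrow> 'a \<Rightarrow> real"
  where "neg_inner v w = - (v \<bullet> w)"

text \<open>A module over the Clifford algebra of \<open>(V, g)\<close>, with the sign convention
  \<open>v\<^sup>2 = - g v v\<close>, is given by its Clifford multiplication \<open>c :: V \<Rightarrow> End S\<close>: by the universal
  property, the Clifford relation is exactly what is needed for \<open>c\<close> to extend (uniquely) to a unital
  algebra homomorphism. As \<open>V\<close> generates the algebra, submodules are the subspaces that are stable
  under all \<open>c v\<close>.\<close>

definition clifford_module ::
    "('v::real_vector \<Rightarrow> 'v \<Rightarrow> real) \<Rightarrow> ('v \<Rightarrow> 's::real_vector \<Rightarrow> 's) \<Rightarrow> bool"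
  where "clifford_module g c \<longleftrightarrow> bilinear c \<and> (\<forall>v s. c v (c v s) = - g v v *\<^sub>R s)"

definition irreducible_clifford_module ::
    "('v::real_vector \<Rightarrow> 'v \<Rightarrow> real) \<Rightarrow> ('v \<Rightarrow> 's::real_vector \<Rightarrow> 's) \<Rightarrow> bool"
  where "irreducible_clifford_module g c \<longleftrightarrow>
    clifford_module g c \<and> (UNIV :: 's set) \<noteq> {0} \<and>
    (\<forall>W. subspace W \<and> (\<forall>v. \<forall>s\<in>W. c v s \<in> W) \<longrightarrow> W = {0} \<or> W = UNIV)"

text \<open>The action of \<open>v \<and> w\<close> under the embedding \<open>v \<and> w \<mapsto> 1/4 [v, w]\<close> of the orthogonal Lie
  algebra into the Clifford algebra.\<close>

definition spin_action :: "('v \<Rightarrow> 's::real_vector \<Rightarrow> 's) \<Rightarrow> 'v \<Rightarrow> 'v \<Rightarrow> 's \<Rightarrow> 's"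
  where "spin_action c v w s = (1 / 4) *\<^sub>R (c v (c w s) - c w (c v s))"

text \<open>The bivectors \<open>v \<and> w\<close> span the orthogonal Lie algebra, so it suffices to commute with them.\<close>

definition schur_algebra :: "('v \<Rightarrow> 's::real_vector \<Rightarrow> 's) \<Rightarrow> ('s \<Rightarrow> 's) set"
  where "schur_algebra c =
    {C. linear C \<and> (\<forall>v w. C \<circ> spin_action c v w = spin_action c v w \<circ> C)}"

definition orthonormal_frame :: "'a::euclidean_space list \<Rightarrow> bool"
  where "orthonormal_frame es \<longleftrightarrow> length es = DIM('a) \<and>
    (\<forall>i < length es. \<forall>j < length es.
       neg_inner (es ! i) (es ! j) = (if i = j then - 1 else 0))"

text \<open>The action of the Clifford product \<open>e\<^sub>1 \<cdots> e\<^sub>m\<close> of the vectors of \<open>[e\<^sub>1, \<dots>, e\<^sub>m]\<close>.\<close>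

definition volume_action :: "('a \<Rightarrow> 's \<Rightarrow> 's) \<Rightarrow> 'a list \<Rightarrow> 's \<Rightarrow> 's"
  where "volume_action c es = foldr (\<lambda>e f. c e \<circ> f) es id"

text \<open>Conjugation on \<open>\<real> Id + \<real> J\<close>, i.e. the linear map fixing \<open>Id\<close> and sending \<open>J\<close> to \<open>- J\<close>. The
  definite description is meaningful for arguments in \<open>\<real> Id + \<real> J\<close> (with \<open>Id\<close> and \<open>J\<close> linearly
  independent), which is the Schur algebra in the dimensions considered.\<close>

definition schur_conj :: "('s::real_vector \<Rightarrow> 's) \<Rightarrow> ('s \<Rightarrow> 's) \<Rightarrow> 's \<Rightarrow> 's"
  where "schur_conj J C =
    (THE D. \<exists>a b. C = (\<lambda>s. a *\<^sub>R s + b *\<^sub>R J s) \<and> D = (\<lambda>s. a *\<^sub>R s - b *\<^sub>R J s))"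

definition J_hermitian :: "('s::real_vector \<Rightarrow> 's) \<Rightarrow> ('s \<Rightarrow> 's \<Rightarrow> real) \<Rightarrow> bool"
  where "J_hermitian J \<Gamma> \<longleftrightarrow> bilinear \<Gamma> \<and> (\<forall>s t. \<Gamma> (J s) (J t) = \<Gamma> s t)"


section \<open>Minkowski space and its spinors\<close>

text \<open>\<open>(e, x, y)\<close> stands for \<open>e + x p + y q\<close>.\<close>

fun mink_inner :: "'a::euclidean_space \<times> real \<times> real \<Rightarrow> 'a \<times> real \<times> real \<Rightarrow> real"
  where "mink_inner (e, x, y) (f, x', y') = neg_inner e f + x * y' + y * x'"

definition mink_p :: "'a::euclidean_space \<times> real \<times> real"
  where "mink_p = (0, 1, 0)"

text \<open>The endomorphism of \<open>S\<^sub>- + S\<^sub>+\<close> with upper right block \<open>sqrt 2 \<cdot> e\<close> and all other blocks zero.\<close>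

definition upper_block :: "('a \<Rightarrow> 's::real_vector \<Rightarrow> 's) \<Rightarrow> 'a \<Rightarrow> 's \<times> 's \<Rightarrow> 's \<times> 's"
  where "upper_block c e Q = (sqrt 2 *\<^sub>R c e (snd Q), 0)"

text \<open>An irreducible Clifford module structure \<open>cm\<close> of Minkowski space on the vector space
  \<open>S\<^sub>- + S\<^sub>+\<close> with \<open>S\<^sub>- = S\<^sub>+\<close> the given Clifford module of \<open>E\<close>, such that \<open>p \<and> e\<close> acts by
  \<^term>\<open>upper_block c e\<close>.\<close>

definition mink_spinor_module ::
    "('a::euclidean_space \<Rightarrow> 's::real_vector \<Rightarrow> 's) \<Rightarrow>
     ('a \<times> real \<times> real \<Rightarrow> 's \<times> 's \<Rightarrow> 's \<times> 's) \<Rightarrow> bool"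
  where "mink_spinor_module c cm \<longleftrightarrow>
    irreducible_clifford_module mink_inner cm \<and>
    (\<forall>e. spin_action cm mink_p (e, 0, 0) = upper_block c e)"


section \<open>The Heisenberg algebra and its spin representations\<close>

text \<open>\<open>(\<alpha>, e, x)\<close> stands for \<open>\<alpha> + e + x p\<close> with \<open>\<alpha>\<close> in the dual space of \<open>E\<close>.\<close>

type_synonym 'a heis = "('a \<Rightarrow>\<^sub>L real) \<times> 'a \<times> real"

definition flat :: "'a::euclidean_space \<Rightarrow> 'a \<Rightarrow>\<^sub>L real"
  where "flat e = Blinfun (neg_inner e)"

lemma blinfun_apply_flat: "blinfun_apply (flat e) f = neg_inner e f"
proof -
  have "bounded_linear (neg_inner e)"
    unfolding neg_inner_def by (intro bounded_linear_minus bounded_linear_inner_right)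
  then show ?thesis
    by (simp add: flat_def bounded_linear_Blinfun_apply)
qed

lemma bij_flat: "bij (flat :: 'a::euclidean_space \<Rightarrow> _)"
proof (rule bijI)
  show "inj (flat :: 'a \<Rightarrow> _)"
  proof (rule injI)
    fix x y :: 'a assume "flat x = flat y"
    then have "x \<bullet> f = y \<bullet> f" for f
      using blinfun_apply_flat[of x f] blinfun_apply_flat[of y f] by (simp add: neg_inner_def)
    then show "x = y" by (metis vector_eq_rdot inner_commute)
  qed
  show "surj (flat :: 'a \<Rightarrow> _)"
  proof (rule surjI)
    fix \<alpha> :: "'a \<Rightarrow>\<^sub>L real"
    show "flat (- (\<Sum>i\<in>Basis. blinfun_apply \<alpha> i *\<^sub>R i)) = \<alpha>"
      by (rule blinfun_euclidean_eqI)
        (simp add: blinfun_apply_flat neg_inner_def inner_sum_left inner_Basis if_distrib cong: if_cong)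
  qed
qed

definition nondegenerate :: "('a::real_vector \<Rightarrow> 'a \<Rightarrow> real) \<Rightarrow> bool"
  where "nondegenerate b \<longleftrightarrow> (\<forall>e. (\<forall>f. b e f = 0) \<longrightarrow> e = 0)"

text \<open>The endomorphism \<open>B\<close> with \<open>b = - \<langle>B \<cdot>, \<cdot>\<rangle>\<close>.\<close>

definition form_endo :: "('a::euclidean_space \<Rightarrow> 'a \<Rightarrow> real) \<Rightarrow> 'a \<Rightarrow> 'a"
  where "form_endo b = (THE B. linear B \<and> (\<forall>e f. b e f = - neg_inner (B e) f))"

fun heis_bracket ::
    "('a::euclidean_space \<Rightarrow> 'a \<Rightarrow> real) \<Rightarrow> 'a heis \<Rightarrow> 'a heis \<Rightarrow> 'a heis"
  where "heis_bracket b (\<alpha>, e, x) (\<beta>, f, y) = (0, 0, b (inv flat \<alpha>) f - b (inv flat \<beta>) e)"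

lemma heis_bracket_flat:
  fixes b :: "'a::euclidean_space \<Rightarrow> 'a \<Rightarrow> real"
  assumes "bilinear b"
  shows "heis_bracket b (flat e, 0, 0) (0, f, 0) = (0, 0, b e f)"
    and "heis_bracket b (flat e, 0, 0) (flat f, 0, 0) = 0"
    and "heis_bracket b (0, e, 0) (0, f, 0) = 0"
proof -
  have inv: "inv flat (flat x) = x" for x :: 'a
    by (rule inv_f_f[OF bij_is_inj[OF bij_flat]])
  have "flat 0 = (0 :: 'a \<Rightarrow>\<^sub>L real)"
    by (rule blinfun_eqI) (simp add: blinfun_apply_flat neg_inner_def)
  with inv[of 0] have inv0: "inv flat 0 = (0 :: 'a)" by simp
  show "heis_bracket b (flat e, 0, 0) (0, f, 0) = (0, 0, b e f)"
    and "heis_bracket b (flat e, 0, 0) (flat f, 0, 0) = 0"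
    and "heis_bracket b (0, e, 0) (0, f, 0) = 0"
    by (simp_all add: inv inv0 bilinear_lzero[OF assms] bilinear_rzero[OF assms] zero_prod_def)
qed

definition heis_p :: "'a::euclidean_space heis"
  where "heis_p = (0, 0, 1)"

definition lie_representation ::
    "('l::real_vector \<Rightarrow> 'l \<Rightarrow> 'l) \<Rightarrow> ('l \<Rightarrow> 'v::real_vector \<Rightarrow> 'v) \<Rightarrow> bool"
  where "lie_representation br \<rho> \<longleftrightarrow> bilinear \<rho> \<and>
    (\<forall>x y v. \<rho> (br x y) v = \<rho> x (\<rho> y v) - \<rho> y (\<rho> x v))"

definition spin_representation ::
    "('a::euclidean_space \<Rightarrow> 'a \<Rightarrow> real) \<Rightarrow> ('a \<Rightarrow> 's::real_vector \<Rightarrow> 's) \<Rightarrow>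
     ('a heis \<Rightarrow> 's \<times> 's \<Rightarrow> 's \<times> 's) \<Rightarrow> bool"
  where "spin_representation b c \<rho> \<longleftrightarrow>
    lie_representation (heis_bracket b) \<rho> \<and>
    (\<forall>e. \<rho> (flat e, 0, 0) = upper_block c (form_endo b e))"

definition zero_charge :: "('a::euclidean_space heis \<Rightarrow> 's::real_vector \<times> 's \<Rightarrow> 's \<times> 's) \<Rightarrow> bool"
  where "zero_charge \<rho> \<longleftrightarrow> (\<forall>Q. \<rho> heis_p Q = 0)"

text \<open>The upper left and upper right blocks of \<open>\<rho>(e)\<close> with respect to \<open>S\<^sub>- + S\<^sub>+\<close>.\<close>

definition rho11 :: "('a::euclidean_space heis \<Rightarrow> 's::real_vector \<times> 's \<Rightarrow> 's \<times> 's) \<Rightarrow> 'a \<Rightarrow> 's \<Rightarrow> 's"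
  where "rho11 \<rho> e s = fst (\<rho> (0, e, 0) (s, 0))"

definition rho12 :: "('a::euclidean_space heis \<Rightarrow> 's::real_vector \<times> 's \<Rightarrow> 's \<times> 's) \<Rightarrow> 'a \<Rightarrow> 's \<Rightarrow> 's"
  where "rho12 \<rho> e s = fst (\<rho> (0, e, 0) (0, s))"

text \<open>Bilinearity of \<open>\<rho>\<^sub>1\<^sub>1\<close> and \<open>\<rho>\<^sub>1\<^sub>2\<close> expresses that they are linear maps into the endomorphisms;
  \<open>\<rho>\<^sub>1\<^sub>1\<close> moreover takes its values in the Schur algebra.\<close>

definition suitable_pair ::
    "('a::euclidean_space \<Rightarrow> 's::real_vector \<Rightarrow> 's) \<Rightarrow> ('s \<Rightarrow> 's) \<Rightarrow>
     ('a \<Rightarrow> 's \<Rightarrow> 's) \<Rightarrow> ('a \<Rightarrow> 's \<Rightarrow> 's) \<Rightarrow> bool"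
  where "suitable_pair c J r11 r12 \<longleftrightarrow>
    bilinear r11 \<and> (\<forall>e. r11 e \<in> schur_algebra c) \<and> bilinear r12 \<and>
    (\<forall>e f s. r11 e (r11 f s) - r11 f (r11 e s) = 0) \<and>
    (\<forall>e f s. r11 e (r12 f s) - r12 f (schur_conj J (r11 e) s) =
             r11 f (r12 e s) - r12 e (schur_conj J (r11 f) s))"


section \<open>Superizations\<close>

text \<open>The even and odd parts are \<open>G 0\<close> and \<open>G 1\<close>; the last two conditions are super skew-symmetry
  and the super Jacobi identity.\<close>

definition lie_superalgebra :: "(nat \<Rightarrow> 'g::real_vector set) \<Rightarrow> ('g \<Rightarrow> 'g \<Rightarrow> 'g) \<Rightarrow> bool"
  where "lie_superalgebra G br \<longleftrightarrow>
    subspace (G 0) \<and> subspace (G 1) \<and> G 0 \<inter> G 1 = {0} \<and>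
    (\<forall>x. \<exists>u\<in>G 0. \<exists>v\<in>G 1. x = u + v) \<and>
    bilinear br \<and>
    (\<forall>i\<in>{0, 1}. \<forall>j\<in>{0, 1}. \<forall>x\<in>G i. \<forall>y\<in>G j. br x y \<in> G ((i + j) mod 2)) \<and>
    (\<forall>i\<in>{0, 1}. \<forall>j\<in>{0, 1}. \<forall>x\<in>G i. \<forall>y\<in>G j. br x y = - ((- 1) ^ (i * j) *\<^sub>R br y x)) \<and>
    (\<forall>i\<in>{0, 1}. \<forall>j\<in>{0, 1}. \<forall>x\<in>G i. \<forall>y\<in>G j. \<forall>z.
       br x (br y z) = br (br x y) z + (- 1) ^ (i * j) *\<^sub>R br y (br x z))"

definition super_grading :: "nat \<Rightarrow> ('l::real_vector \<times> 'v::real_vector) set"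
  where "super_grading i = (if i = 0 then UNIV \<times> {0} else {0} \<times> UNIV)"

definition odd_adjoint ::
    "('l::real_vector \<times> 'v::real_vector \<Rightarrow> 'l \<times> 'v \<Rightarrow> 'l \<times> 'v) \<Rightarrow> 'l \<Rightarrow> 'v \<Rightarrow> 'v"
  where "odd_adjoint br x Q = snd (br (x, 0) (0, Q))"

definition superization ::
    "('a::euclidean_space \<Rightarrow> 'a \<Rightarrow> real) \<Rightarrow> ('a \<Rightarrow> 's::real_vector \<Rightarrow> 's) \<Rightarrow>
     ('a heis \<times> ('s \<times> 's) \<Rightarrow> 'a heis \<times> ('s \<times> 's) \<Rightarrow> 'a heis \<times> ('s \<times> 's)) \<Rightarrow> bool"
  where "superization b c br \<longleftrightarrow>
    lie_superalgebra super_grading br \<and>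
    (\<forall>x y. br (x, 0) (y, 0) = (heis_bracket b x y, 0)) \<and>
    spin_representation b c (odd_adjoint br)"

definition zero_charge_superization ::
    "('a::euclidean_space \<Rightarrow> 'a \<Rightarrow> real) \<Rightarrow> ('a \<Rightarrow> 's::real_vector \<Rightarrow> 's) \<Rightarrow>
     ('a heis \<times> ('s \<times> 's) \<Rightarrow> 'a heis \<times> ('s \<times> 's) \<Rightarrow> 'a heis \<times> ('s \<times> 's)) \<Rightarrow> bool"
  where "zero_charge_superization b c br \<longleftrightarrow>
    superization b c br \<and> zero_charge (odd_adjoint br)"

text \<open>The subspace \<open>[S, S]\<close>.\<close>

definition odd_bracket_span ::
    "('l::real_vector \<times> 'v::real_vector \<Rightarrow> 'l \<times> 'v \<Rightarrow> 'l \<times> 'v) \<Rightarrow> ('l \<times> 'v) set"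
  where "odd_bracket_span br = span {br (0, Q) (0, Q') | Q Q'. True}"

text \<open>The form defined by \<open>[Q, Q'] = p(Q, Q') p\<close>; meaningful when \<open>[S, S]\<close> is contained in \<open>\<real> p\<close>.\<close>

definition p_form ::
    "('a::euclidean_space heis \<times> ('s::real_vector \<times> 's) \<Rightarrow> 'a heis \<times> ('s \<times> 's) \<Rightarrow>
      'a heis \<times> ('s \<times> 's)) \<Rightarrow> 's \<times> 's \<Rightarrow> 's \<times> 's \<Rightarrow> real"
  where "p_form br Q Q' = (THE r. br (0, Q) (0, Q') = r *\<^sub>R (heis_p, 0))"

definition p_mm ::
    "('a::euclidean_space heis \<times> ('s::real_vector \<times> 's) \<Rightarrow> 'a heis \<times> ('s \<times> 's) \<Rightarrow>
      'a heis \<times> ('s \<times> 's)) \<Rightarrow> 's \<Rightarrow> 's \<Rightarrow> real"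
  where "p_mm br s t = p_form br (s, 0) (t, 0)"

definition p_mp ::
    "('a::euclidean_space heis \<times> ('s::real_vector \<times> 's) \<Rightarrow> 'a heis \<times> ('s \<times> 's) \<Rightarrow>
      'a heis \<times> ('s \<times> 's)) \<Rightarrow> 's \<Rightarrow> 's \<Rightarrow> real"
  where "p_mp br s t = p_form br (s, 0) (0, t)"

definition p_pp ::
    "('a::euclidean_space heis \<times> ('s::real_vector \<times> 's) \<Rightarrow> 'a heis \<times> ('s \<times> 's) \<Rightarrow>
      'a heis \<times> ('s \<times> 's)) \<Rightarrow> 's \<Rightarrow> 's \<Rightarrow> real"
  where "p_pp br s t = p_form br (0, s) (0, t)"

end

theory Submission
  imports Defs
begin

text \<open>
  Write \<open>m = DIM('a)\<close>, so that \<open>m \<equiv> 2\<close> modulo 8 and unit vectors of \<open>E\<close> square to \<open>+1\<close> in the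
  Clifford algebra. Everything rests on one fact about this algebra: the irreducible module \<open>S\<close> is
  of real type. It is used in the form of a single vector \<open>s0 \<noteq> 0\<close> such that every operator commuting
  with Clifford multiplication multiplies \<open>s0\<close> by a real number, and such that every alternating form
  for which vectors act symmetrically has \<open>s0\<close> in its radical (\<open>real_type_vector\<close>). As eigenspaces
  and radicals are submodules, irreducibility turns this into two statements about \<open>S\<close>: the commutant
  of Clifford multiplication is \<open>\<real>\<close> (\<open>commutant_real\<close>), and such alternating forms vanish
  (\<open>alternating_form_zero\<close>). Twisting by the volume element \<open>J\<close>, which anticommutes with vectors and
  squares to \<open>-1\<close>, these give that a pair of operators intertwined by all vectors is
  \<open>(x + y J, x - y J)\<close> (\<open>intertwining_pair\<close>) and that symmetric forms with skew vectors vanish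
  (\<open>symmetric_form_zero\<close>).

  The vector \<open>s0\<close> comes from shrinking the module. If \<open>p\<close> and \<open>q\<close> are two of the anticommuting
  generators and \<open>p\<^sup>2 = 1\<close>, then the fixed space of \<open>p\<close> is irreducible under the products of \<open>q\<close> with
  the remaining generators (\<open>irreducible_eigenspace\<close>); this reflects that the Clifford algebra consists
  of the \<open>2 \<times> 2\<close> matrices over a Clifford algebra with two generators fewer. Multiplying four
  generators by their product flips the signs of their squares (\<open>flip_four\<close>). One reduction followed
  by repetitions of a flip and four reductions removes two and then eight generators at a time, until
  no generators are left and the module is a line.

  For a zero charge spin representation, \<open>\<rho>(e\<^sup>\<flat>)\<close> commutes with \<open>\<rho>(f)\<close>. As \<open>B\<close> is
  invertible, this says that every vector \<open>v\<close> intertwines the diagonal blocks of \<open>\<rho>(f)\<close>, so these are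
  \<open>x + y J\<close> and its conjugate; the suitability of \<open>(\<rho>\<^sub>1\<^sub>1, \<rho>\<^sub>1\<^sub>2)\<close> is then the commutativity of \<open>\<rho>(E)\<close>.

  As \<open>heis_p\<close> is central, the Jacobi identity makes the form \<open>p(\<cdot>,\<cdot>)\<close> invariant under \<open>\<rho>\<close>. Invariance under
  the upper triangular operators \<open>\<rho>(e\<^sup>\<flat>)\<close> kills \<open>p\<^sub>-\<^sub>-\<close>, because its arguments can be divided by unit
  vectors, and gives \<open>p\<^sub>-\<^sub>+(v s, t) = - p\<^sub>-\<^sub>+(v t, s)\<close>. The symmetric part of a form with this property
  has skew vectors and its alternating part has symmetric vectors, so both vanish. Finally, for
  \<open>p\<^sub>+\<^sub>+ \<noteq> 0\<close> to be invariant under \<open>x - y J\<close> requires \<open>x = 0\<close> and, when \<open>y \<noteq> 0\<close>, hermitian symmetry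
  (\<open>invariant_form_hermitian\<close>).\<close>

section \<open>Families of anticommuting operators\<close>

definition anticommute_on :: "'s::real_vector set \<Rightarrow> ('s \<Rightarrow> 's) \<Rightarrow> ('s \<Rightarrow> 's) \<Rightarrow> bool"
  where "anticommute_on W f g \<longleftrightarrow> (\<forall>s\<in>W. f (g s) = - g (f s))"

text \<open>A Clifford family on a subspace \<open>W\<close> lists anticommuting operators together with the signs of their
squares, i.e. it makes \<open>W\<close> a module over a Clifford algebra of some signature. The operators
are defined on all of the ambient space, since the inductions below pass to ever smaller subspaces \<open>W\<close>
of one type; apart from linearity, only their restrictions to \<open>W\<close> matter.\<close>

definition clifford_family :: "'s::real_vector set \<Rightarrow> (real \<times> ('s \<Rightarrow> 's)) list \<Rightarrow> bool"
  where "clifford_family W L \<longleftrightarrow> subspace W \<and>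
    (\<forall>\<epsilon> f. (\<epsilon>, f) \<in> set L \<longrightarrow> (\<epsilon> = 1 \<or> \<epsilon> = - 1) \<and> linear f \<and>
       (\<forall>s\<in>W. f s \<in> W \<and> f (f s) = \<epsilon> *\<^sub>R s)) \<and>
    sorted_wrt (\<lambda>x y. anticommute_on W (snd x) (snd y)) L"

definition irreducible_family :: "'s::real_vector set \<Rightarrow> (real \<times> ('s \<Rightarrow> 's)) list \<Rightarrow> bool"
  where "irreducible_family W L \<longleftrightarrow> clifford_family W L \<and> W \<noteq> {0} \<and>
    (\<forall>U. subspace U \<and> U \<subseteq> W \<and> (\<forall>\<epsilon> f. (\<epsilon>, f) \<in> set L \<longrightarrow> (\<forall>s\<in>U. f s \<in> U)) \<longrightarrow>
       U = {0} \<or> U = W)"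

text \<open>The forms considered are those for which each operator is symmetric or skew according to the sign of
its square. An invariant inner product has this property, and it is the rule that is
compatible with both reductions below.\<close>

definition real_type_vector :: "'s::real_vector set \<Rightarrow> (real \<times> ('s \<Rightarrow> 's)) list \<Rightarrow> 's \<Rightarrow> bool"
  where "real_type_vector W L s0 \<longleftrightarrow> s0 \<in> W \<and> s0 \<noteq> 0 \<and>
    (\<forall>C. linear C \<and> (\<forall>s\<in>W. C s \<in> W) \<and> (\<forall>\<epsilon> f. (\<epsilon>, f) \<in> set L \<longrightarrow> (\<forall>s\<in>W. C (f s) = f (C s)))
       \<longrightarrow> (\<exists>r. C s0 = r *\<^sub>R s0)) \<and>
    (\<forall>\<beta> :: 's \<Rightarrow> 's \<Rightarrow> real. bilinear \<beta> \<and> (\<forall>s\<in>W. \<forall>t\<in>W. \<beta> s t = - \<beta> t s) \<and>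
       (\<forall>\<epsilon> f. (\<epsilon>, f) \<in> set L \<longrightarrow> (\<forall>s\<in>W. \<forall>t\<in>W. \<beta> (f s) t = \<epsilon> * \<beta> s (f t)))
       \<longrightarrow> (\<forall>t\<in>W. \<beta> s0 t = 0))"

lemma clifford_family_Cons:
  "clifford_family W ((\<epsilon>, f) # L) \<longleftrightarrow> clifford_family W L \<and> (\<epsilon> = 1 \<or> \<epsilon> = - 1) \<and> linear f \<and>
     (\<forall>s\<in>W. f s \<in> W \<and> f (f s) = \<epsilon> *\<^sub>R s) \<and> (\<forall>\<delta> g. (\<delta>, g) \<in> set L \<longrightarrow> anticommute_on W f g)"
  unfolding clifford_family_def by (fastforce simp del: scaleR_minus_left)

lemma clifford_familyD:
  assumes "clifford_family W L" "(\<epsilon>, f) \<in> set L"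
  shows "\<epsilon> = 1 \<or> \<epsilon> = - 1" "linear f" "s \<in> W \<Longrightarrow> f s \<in> W" "s \<in> W \<Longrightarrow> f (f s) = \<epsilon> *\<^sub>R s"
  using assms unfolding clifford_family_def by blast+

lemma real_type_vector_commutant:
  assumes "real_type_vector W L s0" "linear C" "\<forall>s\<in>W. C s \<in> W"
    and "\<forall>\<epsilon> f. (\<epsilon>, f) \<in> set L \<longrightarrow> (\<forall>s\<in>W. C (f s) = f (C s))"
  shows "\<exists>r. C s0 = r *\<^sub>R s0"
  using assms unfolding real_type_vector_def by blast

lemma real_type_vector_form:
  fixes \<beta> :: "'s::real_vector \<Rightarrow> 's \<Rightarrow> real"
  assumes "real_type_vector W L s0" "bilinear \<beta>" "\<forall>s\<in>W. \<forall>t\<in>W. \<beta> s t = - \<beta> t s"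
    and "\<forall>\<epsilon> f. (\<epsilon>, f) \<in> set L \<longrightarrow> (\<forall>s\<in>W. \<forall>t\<in>W. \<beta> (f s) t = \<epsilon> * \<beta> s (f t))"
  shows "\<forall>t\<in>W. \<beta> s0 t = 0"
  using assms(1)[unfolded real_type_vector_def, THEN conjunct2, THEN conjunct2, THEN conjunct2,
    THEN spec, THEN mp, OF conjI[OF assms(2) conjI[OF assms(3,4)]]] .

lemma anticommute_onD: "anticommute_on W f g \<Longrightarrow> s \<in> W \<Longrightarrow> f (g s) = - g (f s)"
  unfolding anticommute_on_def by blast

text \<open>Since \<open>q\<close> anticommutes with \<open>p\<close>, it exchanges the two eigenspaces of \<open>p\<close>, and \<open>W\<close> is
\<open>V \<oplus> q V\<close> for the fixed space \<open>V\<close>. Each remaining generator is \<open>q\<close> times an operator that commutes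
with \<open>p\<close>. Hence an invariant subspace \<open>U\<close> of \<open>V\<close> generates \<open>U \<oplus> q U\<close> inside \<open>W\<close>, and
irreducibility of \<open>W\<close> forces \<open>U\<close> to be trivial.\<close>

lemma irreducible_eigenspace:
  assumes irr: "irreducible_family W ((1, p) # (\<epsilon>, q) # L)"
  shows "irreducible_family {s\<in>W. p s = s} (map (\<lambda>(\<delta>, f). (- \<epsilon> * \<delta>, q \<circ> f)) L)"
proof -
  let ?V = "{s\<in>W. p s = s}"
  have fam: "clifford_family W L" and \<epsilon>: "\<epsilon> = 1 \<or> \<epsilon> = -1"
    and lin: "linear p" "linear q" and nz: "W \<noteq> {0}"
    and pq: "\<And>s. s \<in> W \<Longrightarrow> p s \<in> W" "\<And>s. s \<in> W \<Longrightarrow> q s \<in> W"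
      "\<And>s. s \<in> W \<Longrightarrow> p (p s) = 1 *\<^sub>R s" "\<And>s. s \<in> W \<Longrightarrow> q (q s) = \<epsilon> *\<^sub>R s"
    and anti: "anticommute_on W p q" "\<And>\<delta> f. (\<delta>, f) \<in> set L \<Longrightarrow> anticommute_on W p f"
      "\<And>\<delta> f. (\<delta>, f) \<in> set L \<Longrightarrow> anticommute_on W q f"
    using irr unfolding irreducible_family_def clifford_family_Cons list.set by blast+
  note linL = clifford_familyD(2)[OF fam] and sgn = clifford_familyD(1)[OF fam]
    and mem = pq(1,2) clifford_familyD(3)[OF fam]
    and sq = pq(3)[unfolded scaleR_one] pq(4) clifford_familyD(4)[OF fam]
    and ac = anticommute_onD[OF anti(1)] anticommute_onD[OF anti(2)] anticommute_onD[OF anti(3)]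
  have W: "subspace W" and acL: "sorted_wrt (\<lambda>x y. anticommute_on W (snd x) (snd y)) L"
    using fam unfolding clifford_family_def by blast+
  have min: "U = {0} \<or> U = W" if "subspace U" "U \<subseteq> W" "\<And>s. s \<in> U \<Longrightarrow> p s \<in> U" "\<And>s. s \<in> U \<Longrightarrow> q s \<in> U"
      "\<And>\<delta> f s. (\<delta>, f) \<in> set L \<Longrightarrow> s \<in> U \<Longrightarrow> f s \<in> U" for U
  proof -
    have "\<forall>\<delta> f. (\<delta>, f) \<in> set ((1, p) # (\<epsilon>, q) # L) \<longrightarrow> (\<forall>s\<in>U. f s \<in> U)"
      using that(3-5) by auto
    then show ?thesis
      using irr that(1,2) unfolding irreducible_family_def by blast
  qed
  have V: "subspace ?V"
    using W lin by (auto simp: subspace_def linear_add linear_scale linear_0)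
  have "clifford_family ?V (map (\<lambda>(\<delta>, f). (- \<epsilon> * \<delta>, q \<circ> f)) L)"
    unfolding clifford_family_def
  proof (intro conjI V)
    show "\<forall>\<delta> g. (\<delta>, g) \<in> set (map (\<lambda>(\<delta>, f). (- \<epsilon> * \<delta>, q \<circ> f)) L) \<longrightarrow> (\<delta> = 1 \<or> \<delta> = - 1) \<and> linear g \<and>
       (\<forall>s\<in>?V. g s \<in> ?V \<and> g (g s) = \<delta> *\<^sub>R s)"
    proof clarsimp
      fix \<delta> f assume f: "(\<delta>, f) \<in> set L"
      have "q (f (q (f s))) = - (\<epsilon> * \<delta>) *\<^sub>R s" if "s \<in> W" for s
      proof -
        have "f (q (f s)) = - q (f (f s))"
          using ac(3)[OF f mem(3)[OF f that]] by simp
        then show ?thesis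
          using sq(3)[OF f that] sq(2)[OF that] lin that
          by (simp add: linear_neg linear_scale mult.commute)
      qed
      moreover have "p (q (f s)) = q (f (p s))" if "s \<in> W" for s
        using ac(1)[OF mem(3)[OF f that]] ac(2)[OF f that] lin by (simp add: linear_neg)
      ultimately show "(\<epsilon> * \<delta> = - 1 \<or> \<epsilon> * \<delta> = 1) \<and> linear (q \<circ> f) \<and>
          (\<forall>s. s \<in> W \<and> p s = s \<longrightarrow> q (f s) \<in> W \<and> p (q (f s)) = q (f s) \<and>
             q (f (q (f s))) = - ((\<epsilon> * \<delta>) *\<^sub>R s))"
        using \<epsilon> sgn[OF f] mem(2) mem(3)[OF f] linear_compose[OF linL[OF f] lin(2)] by auto
    qed
    have comp: "anticommute_on ?V (q \<circ> f) (q \<circ> g)"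
      if "(\<delta>, f) \<in> set L" "(\<gamma>, g) \<in> set L" "anticommute_on W f g" for \<delta> f \<gamma> g
      unfolding anticommute_on_def
    proof
      fix s assume "s \<in> ?V"
      then have s: "s \<in> W" by blast
      have "f (q (g s)) = - q (f (g s))" "g (q (f s)) = - q (g (f s))"
        using ac(3)[OF that(1) mem(3)[OF that(2) s]] ac(3)[OF that(2) mem(3)[OF that(1) s]]
        by simp_all
      then show "(q \<circ> f) ((q \<circ> g) s) = - (q \<circ> g) ((q \<circ> f) s)"
        using anticommute_onD[OF that(3) s] lin by (simp add: linear_neg)
    qed
    have "anticommute_on ?V (q \<circ> snd x) (q \<circ> snd y)"
      if "x \<in> set L" "y \<in> set L" "anticommute_on W (snd x) (snd y)" for x y
      using comp[of "fst x" "snd x" "fst y" "snd y"] that by simp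
    then show "sorted_wrt (\<lambda>x y. anticommute_on ?V (snd x) (snd y))
        (map (\<lambda>(\<delta>, f). (- \<epsilon> * \<delta>, q \<circ> f)) L)"
      unfolding sorted_wrt_map case_prod_unfold snd_conv
      by (rule sorted_wrt_mono_rel[OF _ acL])
  qed
  moreover have "?V \<noteq> {0}"
  proof -
    obtain s where s: "s \<in> W" "s \<noteq> 0" using nz W subspace_0 by blast
    show ?thesis
    proof (cases "p s = - s")
      case True
      then have "q s \<in> ?V" using s ac(1)[of s] mem lin by (simp add: linear_neg)
      moreover have "q s \<noteq> 0" using sq(2)[of s] s \<epsilon> lin by (auto simp: linear_0)
      ultimately show ?thesis by blast
    next
      case False
      then have "s + p s \<noteq> 0" by (metis add.commute eq_neg_iff_add_eq_0)
      moreover have "s + p s \<in> ?V"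
        using s sq(1)[of s] mem W lin by (auto simp: linear_add subspace_add add.commute)
      ultimately show ?thesis by blast
    qed
  qed
  moreover have "U = {0} \<or> U = ?V"
    if U: "subspace U" "U \<subseteq> ?V" and inv: "\<And>\<delta> f s. (\<delta>, f) \<in> set L \<Longrightarrow> s \<in> U \<Longrightarrow> q (f s) \<in> U" for U
  proof (cases "U = {0}")
    case False
    let ?X = "{u + q v |u v. u \<in> U \<and> v \<in> U}"
    have UX: "u \<in> ?X" if "u \<in> U" for u
      using that subspace_0[OF U(1)] lin by (force simp: linear_0)
    have "?X = (\<lambda>(u, v). u + q v) ` (U \<times> U)" by auto
    moreover have "linear (\<lambda>(u, v). u + q v)"
      by (rule linearI) (auto simp: linear_add[OF lin(2)] linear_scale[OF lin(2)] scaleR_add_right)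
    ultimately have sX: "subspace ?X"
      using linear_subspace_image subspace_Times U(1) by metis
    have "?X = {0} \<or> ?X = W"
    proof (rule min[OF sX])
      show "?X \<subseteq> W" using U mem W by (auto intro!: subspace_add)
      show "p x \<in> ?X" if "x \<in> ?X" for x
      proof -
        obtain u v where x: "x = u + q v" "u \<in> U" "v \<in> U" using \<open>x \<in> ?X\<close> by blast
        then have "p u = u" "p (q v) = - q v" using U ac(1)[of v] lin by auto
        then have "p x = u + q (- v)" using x(1) lin by (simp add: linear_add linear_neg)
        then show ?thesis using x subspace_neg[OF U(1)] by blast
      qed
      show "q x \<in> ?X" if "x \<in> ?X" for x
      proof -
        obtain u v where x: "x = u + q v" "u \<in> U" "v \<in> U" using \<open>x \<in> ?X\<close> by blast
        then have "q x = \<epsilon> *\<^sub>R v + q u" using U sq(2)[of v] lin by (auto simp: linear_add)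
        then show ?thesis using x subspace_scale[OF U(1)] by blast
      qed
      show "f x \<in> ?X" if f: "(\<delta>, f) \<in> set L" and "x \<in> ?X" for \<delta> f x
      proof -
        obtain u v where x: "x = u + q v" "u \<in> U" "v \<in> U" using \<open>x \<in> ?X\<close> by blast
        have "u \<in> W" "v \<in> W" using x U by auto
        have "f u = q (\<epsilon> *\<^sub>R q (f u))"
          using sq(2)[OF mem(3)[OF f \<open>u \<in> W\<close>]] lin \<epsilon> by (auto simp: linear_scale)
        then have "f x = - q (f v) + q (\<epsilon> *\<^sub>R q (f u))"
          using x ac(3)[OF f \<open>v \<in> W\<close>] linL[OF f] by (simp add: linear_add)
        then show ?thesis
          using inv[OF f x(2)] inv[OF f x(3)] subspace_neg[OF U(1)] subspace_scale[OF U(1)] by blast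
      qed
    qed
    moreover have "?X \<noteq> {0}" using False UX U(1) subspace_0 by blast
    ultimately have XW: "?X = W" by blast
    have "s \<in> U" if s: "s \<in> W" "p s = s" for s
    proof -
      obtain u v where x: "s = u + q v" "u \<in> U" "v \<in> U" using s(1) XW by blast
      then have "p u = u" "p (q v) = - q v" using U ac(1)[of v] lin by auto
      then have "p s = u - q v" using x(1) lin by (simp add: linear_add)
      then have "q v = - q v" using x s by simp
      then have "q v = 0" by (simp add: eq_neg_iff_add_eq_0 flip: scaleR_2)
      then show ?thesis using x by simp
    qed
    then show ?thesis using U by auto
  qed simp
  ultimately show ?thesis unfolding irreducible_family_def by fastforce
qed

text \<open>A commuting operator preserves the fixed space of \<open>p\<close>. For a compatible form the two
eigenspaces of \<open>p\<close> are orthogonal, because \<open>p\<close> acts symmetrically; so a vector in the radical of the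
restriction to the fixed space lies in the radical of the whole form.\<close>

lemma real_type_vector_eigenspace:
  assumes irr: "clifford_family W ((1, p) # (\<epsilon>, q) # L)"
    and s0: "real_type_vector {s\<in>W. p s = s} (map (\<lambda>(\<delta>, f). (- \<epsilon> * \<delta>, q \<circ> f)) L) s0"
  shows "real_type_vector W ((1, p) # (\<epsilon>, q) # L) s0"
proof -
  have fam: "clifford_family W L" and lin: "linear p" "linear q"
    and pq: "\<And>s. s \<in> W \<Longrightarrow> p s \<in> W" "\<And>s. s \<in> W \<Longrightarrow> q s \<in> W" "\<And>s. s \<in> W \<Longrightarrow> p (p s) = 1 *\<^sub>R s"
    and anti: "\<And>\<delta> f. (\<delta>, f) \<in> set L \<Longrightarrow> anticommute_on W q f"
    using irr unfolding clifford_family_Cons by blast+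
  note mem = pq(1,2) clifford_familyD(3)[OF fam] and sq = pq(3)[unfolded scaleR_one]
    and ac = anticommute_onD[OF anti]
  have W: "subspace W" using fam unfolding clifford_family_def by blast
  have s: "s0 \<in> W" "p s0 = s0" "s0 \<noteq> 0"
    using s0 unfolding real_type_vector_def by blast+
  have s0C: "\<exists>r. C s0 = r *\<^sub>R s0"
    if "linear C" "\<And>s. s \<in> W \<Longrightarrow> p s = s \<Longrightarrow> C s \<in> W \<and> p (C s) = C s"
      "\<And>\<delta> f s. (\<delta>, f) \<in> set L \<Longrightarrow> s \<in> W \<Longrightarrow> p s = s \<Longrightarrow> C (q (f s)) = q (f (C s))" for C
  proof -
    have "\<forall>s\<in>{s\<in>W. p s = s}. C s \<in> {s\<in>W. p s = s}"
      using that(2) by blast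
    moreover have "\<forall>\<gamma> g. (\<gamma>, g) \<in> set (map (\<lambda>(\<delta>, f). (- \<epsilon> * \<delta>, q \<circ> f)) L) \<longrightarrow>
        (\<forall>s\<in>{s\<in>W. p s = s}. C (g s) = g (C s))"
      using that(3) by auto
    ultimately show ?thesis
      using s0 that(1) unfolding real_type_vector_def by blast
  qed
  have s0b: "\<beta> s0 t = 0"
    if "bilinear \<beta>" "\<And>s t. s \<in> W \<Longrightarrow> t \<in> W \<Longrightarrow> \<beta> s t = - \<beta> t s"
      "\<And>\<delta> f s t. (\<delta>, f) \<in> set L \<Longrightarrow> s \<in> W \<Longrightarrow> p s = s \<Longrightarrow> t \<in> W \<Longrightarrow> p t = t \<Longrightarrow>
         \<beta> (q (f s)) t = - \<epsilon> * \<delta> * \<beta> s (q (f t))" "t \<in> W" "p t = t" for \<beta> :: "'a \<Rightarrow> 'a \<Rightarrow> real" and t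
  proof -
    have "\<forall>s\<in>{s\<in>W. p s = s}. \<forall>t\<in>{s\<in>W. p s = s}. \<beta> s t = - \<beta> t s"
      using that(2) by blast
    moreover have "\<forall>\<gamma> g. (\<gamma>, g) \<in> set (map (\<lambda>(\<delta>, f). (- \<epsilon> * \<delta>, q \<circ> f)) L) \<longrightarrow>
        (\<forall>s\<in>{s\<in>W. p s = s}. \<forall>t\<in>{s\<in>W. p s = s}. \<beta> (g s) t = \<gamma> * \<beta> s (g t))"
      using that(3) by auto
    ultimately show ?thesis
      using s0 that(1,4,5) unfolding real_type_vector_def by blast
  qed
  show ?thesis
    unfolding real_type_vector_def
  proof (intro conjI s allI impI ballI)
    fix C assume C: "linear C \<and> (\<forall>s\<in>W. C s \<in> W) \<and>
      (\<forall>\<delta> f. (\<delta>, f) \<in> set ((1, p) # (\<epsilon>, q) # L) \<longrightarrow>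
         (\<forall>s\<in>W. C (f s) = f (C s)))"
    then have c: "\<And>s. s \<in> W \<Longrightarrow> C (p s) = p (C s)" "\<And>s. s \<in> W \<Longrightarrow> C (q s) = q (C s)"
      "\<And>\<delta> f s. (\<delta>, f) \<in> set L \<Longrightarrow> s \<in> W \<Longrightarrow> C (f s) = f (C s)" by auto
    show "\<exists>r. C s0 = r *\<^sub>R s0"
    proof (rule s0C)
      show "C (q (f s)) = q (f (C s))" if "(\<delta>, f) \<in> set L" "s \<in> W" for \<delta> f s
        using c(2)[OF mem(3)[OF that]] c(3)[OF that] by simp
      show "C s \<in> W \<and> p (C s) = C s" if "s \<in> W" "p s = s" for s
        using C c(1)[of s] that by metis
    qed (use C in blast)
  next
    fix \<beta> :: "'a \<Rightarrow> 'a \<Rightarrow> real" and t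
    assume \<beta>: "bilinear \<beta> \<and> (\<forall>s\<in>W. \<forall>t\<in>W. \<beta> s t = - \<beta> t s) \<and>
      (\<forall>\<delta> f. (\<delta>, f) \<in> set ((1, p) # (\<epsilon>, q) # L) \<longrightarrow>
         (\<forall>s\<in>W. \<forall>t\<in>W. \<beta> (f s) t = \<delta> * \<beta> s (f t)))"
      and t: "t \<in> W"
    then have bil: "bilinear \<beta>" and alt: "\<And>s t. s \<in> W \<Longrightarrow> t \<in> W \<Longrightarrow> \<beta> s t = - \<beta> t s"
      by blast+
    have b: "\<And>s t. s \<in> W \<Longrightarrow> t \<in> W \<Longrightarrow> \<beta> (p s) t = \<beta> s (p t)"
      "\<And>s t. s \<in> W \<Longrightarrow> t \<in> W \<Longrightarrow> \<beta> (q s) t = \<epsilon> * \<beta> s (q t)"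
      "\<And>\<delta> f s t. (\<delta>, f) \<in> set L \<Longrightarrow> s \<in> W \<Longrightarrow> t \<in> W \<Longrightarrow> \<beta> (f s) t = \<delta> * \<beta> s (f t)"
      using \<beta>[THEN conjunct2, THEN conjunct2] by auto
    \<comment> \<open>Averaging over \<open>p\<close> projects \<open>t\<close> to the fixed space, at the cost of a factor 2.\<close>
    let ?t = "t + p t"
    have "\<beta> s0 ?t = 0"
    proof (rule s0b[OF bil alt])
      fix \<delta> f s t assume f: "(\<delta>, f) \<in> set L" and "s \<in> W" "t \<in> W"
      then show "\<beta> (q (f s)) t = - \<epsilon> * \<delta> * \<beta> s (q (f t))"
        using b(2)[OF mem(3)[OF f \<open>s \<in> W\<close>] \<open>t \<in> W\<close>] b(3)[OF f \<open>s \<in> W\<close> mem(2)[OF \<open>t \<in> W\<close>]]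
          ac[OF f \<open>t \<in> W\<close>] bilinear_rneg[OF bil] by simp
    qed (use t mem sq lin W in \<open>auto simp: linear_add subspace_add add.commute\<close>)
    moreover have "\<beta> s0 (p t) = \<beta> s0 t" using b(1)[OF s(1) t] s by simp
    ultimately show "\<beta> s0 t = 0" using bilinear_radd[OF bil] by simp
  qed
qed


definition real_type :: "(real \<times> ('s::real_vector \<Rightarrow> 's)) list \<Rightarrow> bool"
  where "real_type L \<longleftrightarrow> (\<forall>W. irreducible_family W L \<longrightarrow> (\<exists>s0. real_type_vector W L s0))"

lemma real_type_step:
  assumes "real_type (map (\<lambda>(\<delta>, f). (- \<epsilon> * \<delta>, q \<circ> f)) L)"
  shows "real_type ((1, p) # (\<epsilon>, q) # L)"
  unfolding real_type_def
proof (intro allI impI)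
  fix W assume irr: "irreducible_family W ((1, p) # (\<epsilon>, q) # L)"
  then have fam: "clifford_family W ((1, p) # (\<epsilon>, q) # L)"
    unfolding irreducible_family_def by (rule conjunct1)
  obtain s0 where "real_type_vector {s\<in>W. p s = s} (map (\<lambda>(\<delta>, f). (- \<epsilon> * \<delta>, q \<circ> f)) L) s0"
    using assms irreducible_eigenspace[OF irr] unfolding real_type_def by blast
  then show "\<exists>s0. real_type_vector W ((1, p) # (\<epsilon>, q) # L) s0"
    by (intro exI real_type_vector_eigenspace[OF fam])
qed

lemma clifford_family_Cons_ball:
  "clifford_family W ((\<epsilon>, f) # L) \<longleftrightarrow> clifford_family W L \<and> (\<epsilon> = 1 \<or> \<epsilon> = - 1) \<and> linear f \<and>
     (\<forall>s\<in>W. f s \<in> W \<and> f (f s) = \<epsilon> *\<^sub>R s) \<and> (\<forall>x\<in>set L. anticommute_on W f (snd x))"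
  unfolding clifford_family_Cons by force

lemma anticommute_on_sym: "anticommute_on W f g \<Longrightarrow> anticommute_on W g f"
  unfolding anticommute_on_def by simp

text \<open>The product \<open>\<omega>\<close> of four anticommuting generators with square \<open>-1\<close> has square \<open>1\<close>, anticommutes with
these four and commutes with all other generators. Multiplying the four by \<open>\<omega>\<close> therefore yields four
generators with square \<open>+1\<close> that anticommute among themselves and with the rest, and generate the same
algebra. Reversing the order of a product of four factors is an even permutation, so the
operators \<open>\<omega> a\<close> are symmetric for compatible forms, in accordance with their new signs.

The positive and negative generators are interleaved so that consecutive pairs can be split off
by the eigenspace reduction.\<close>

lemma flip_four:
  assumes irr: "irreducible_family W ((-1, a) # (-1, x) # (-1, b) # (-1, y) # (-1, c) # (-1, z) #
      (-1, d) # (-1, w) # L)" (is "irreducible_family W ?old")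
    and \<omega>: "\<omega> = a \<circ> b \<circ> c \<circ> d"
  shows "irreducible_family W ((1, \<omega> \<circ> a) # (-1, x) # (1, \<omega> \<circ> b) # (-1, y) # (1, \<omega> \<circ> c) #
      (-1, z) # (1, \<omega> \<circ> d) # (-1, w) # L)" (is "irreducible_family W ?new")
    and "real_type_vector W ((1, \<omega> \<circ> a) # (-1, x) # (1, \<omega> \<circ> b) # (-1, y) # (1, \<omega> \<circ> c) #
      (-1, z) # (1, \<omega> \<circ> d) # (-1, w) # L) s0 \<Longrightarrow>
      real_type_vector W ((-1, a) # (-1, x) # (-1, b) # (-1, y) # (-1, c) # (-1, z) #
      (-1, d) # (-1, w) # L) s0"
proof -
  let ?R = "(-1, x) # (-1, y) # (-1, z) # (-1, w) # L"
  have old: "clifford_family W ?old" using irr unfolding irreducible_family_def by blast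
  have ins: "(-1, a) \<in> set ?old" "(-1, b) \<in> set ?old" "(-1, c) \<in> set ?old" "(-1, d) \<in> set ?old"
    by simp_all
  note lin = ins[THEN clifford_familyD(2)[OF old]]
    and mem = ins[THEN clifford_familyD(3)[OF old]]
    and sq = ins[THEN clifford_familyD(4)[OF old]]
  have anti: "anticommute_on W a b" "anticommute_on W a c" "anticommute_on W a d"
      "anticommute_on W b c" "anticommute_on W b d" "anticommute_on W c d"
    and antix: "anticommute_on W x b" "anticommute_on W x c" "anticommute_on W x d"
      "anticommute_on W y c" "anticommute_on W y d" "anticommute_on W z d"
    using old by (simp_all add: clifford_family_Cons)
  have antiR: "anticommute_on W a g" "anticommute_on W b g" "anticommute_on W c g" "anticommute_on W d g"
    if "(\<delta>, g) \<in> set ?R" for \<delta> g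
    using old that antix[THEN anticommute_on_sym] by (auto simp: clifford_family_Cons)
  have R: "clifford_family W ?R" using old by (simp add: clifford_family_Cons)
  note lin' = lin[THEN linear_neg]
  note ac = anti[THEN anticommute_on_sym, THEN anticommute_onD]
  have sub: "subspace W" using R unfolding clifford_family_def by blast
  note rules = mem sq ac lin' subspace_neg[OF sub]
  have fam1: "(\<omega> \<circ> f) s \<in> W \<and> (\<omega> \<circ> f) ((\<omega> \<circ> f) s) = s" if "f \<in> {a, b, c, d}" "s \<in> W" for f s
    using that by (auto simp: \<omega> rules)
  have lin1: "linear (\<omega> \<circ> f)" if "f \<in> {a, b, c, d}" for f
    using that lin unfolding \<omega> by (auto intro!: linear_compose)
  have anti1: "anticommute_on W (\<omega> \<circ> a) (\<omega> \<circ> b)" "anticommute_on W (\<omega> \<circ> a) (\<omega> \<circ> c)"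
    "anticommute_on W (\<omega> \<circ> a) (\<omega> \<circ> d)" "anticommute_on W (\<omega> \<circ> b) (\<omega> \<circ> c)"
    "anticommute_on W (\<omega> \<circ> b) (\<omega> \<circ> d)" "anticommute_on W (\<omega> \<circ> c) (\<omega> \<circ> d)"
    unfolding anticommute_on_def by (simp_all add: \<omega> rules)
  have anti2: "anticommute_on W (\<omega> \<circ> f) g" if "f \<in> {a, b, c, d}" "(\<delta>, g) \<in> set ?R" for f \<delta> g
    using that(1) unfolding anticommute_on_def
    by (auto simp: \<omega> rules clifford_familyD(3)[OF R that(2)]
        antiR[OF that(2), THEN anticommute_on_sym, THEN anticommute_onD]
        linear_neg[OF clifford_familyD(2)[OF R that(2)]])
  have anti3: "anticommute_on W (\<omega> \<circ> f) x" "anticommute_on W (\<omega> \<circ> f) y" "anticommute_on W (\<omega> \<circ> f) z"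
    "anticommute_on W (\<omega> \<circ> f) w" "\<forall>v\<in>set L. anticommute_on W (\<omega> \<circ> f) (snd v)"
    if "f \<in> {a, b, c, d}" for f
  proof -
    have *: "anticommute_on W (\<omega> \<circ> f) (snd v)" if "v \<in> set ?R" for v
      using anti2[OF \<open>f \<in> {a, b, c, d}\<close>, of "fst v" "snd v"] that by simp
    show "anticommute_on W (\<omega> \<circ> f) x" "anticommute_on W (\<omega> \<circ> f) y" "anticommute_on W (\<omega> \<circ> f) z"
      "anticommute_on W (\<omega> \<circ> f) w" "\<forall>v\<in>set L. anticommute_on W (\<omega> \<circ> f) (snd v)"
      using *[of "(-1, x)"] *[of "(-1, y)"] *[of "(-1, z)"] *[of "(-1, w)"] * by simp_all
  qed
  have lin1: "linear (\<omega> \<circ> a)" "linear (\<omega> \<circ> b)" "linear (\<omega> \<circ> c)" "linear (\<omega> \<circ> d)"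
    and fam1: "\<forall>s\<in>W. (\<omega> \<circ> a) s \<in> W \<and> (\<omega> \<circ> a) ((\<omega> \<circ> a) s) = s"
      "\<forall>s\<in>W. (\<omega> \<circ> b) s \<in> W \<and> (\<omega> \<circ> b) ((\<omega> \<circ> b) s) = s"
      "\<forall>s\<in>W. (\<omega> \<circ> c) s \<in> W \<and> (\<omega> \<circ> c) ((\<omega> \<circ> c) s) = s"
      "\<forall>s\<in>W. (\<omega> \<circ> d) s \<in> W \<and> (\<omega> \<circ> d) ((\<omega> \<circ> d) s) = s"
    using lin1 fam1 by simp_all
  have new: "clifford_family W ?new"
    using R anti3[of a] anti3[of b] anti3[of c] anti3[of d] anti3(1-4)[THEN anticommute_on_sym]
      lin1 fam1 anti1
    by (simp add: clifford_family_Cons_ball del: o_apply)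
  have old_mem: "(\<delta>, f) \<in> set ?R \<or> \<delta> = -1 \<and> f \<in> {a, b, c, d}" if "(\<delta>, f) \<in> set ?old" for \<delta> f
    using that by auto
  have new_mem: "(\<delta>, f) \<in> set ?R \<or> \<delta> = 1 \<and> (\<exists>h\<in>{a, b, c, d}. f = \<omega> \<circ> h)" if "(\<delta>, f) \<in> set ?new" for \<delta> f
    using that by auto
  have inv: "U = {0} \<or> U = W"
    if U: "subspace U" "U \<subseteq> W" "\<And>f s. f \<in> {a, b, c, d} \<Longrightarrow> s \<in> U \<Longrightarrow> \<omega> (f s) \<in> U"
      "\<And>\<delta> g s. (\<delta>, g) \<in> set ?R \<Longrightarrow> s \<in> U \<Longrightarrow> g s \<in> U" for U
  proof -
    have "f s \<in> U" if f: "f \<in> {a, b, c, d}" and "s \<in> U" for f s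
    proof -
      have "s \<in> W" using U(2) \<open>s \<in> U\<close> by blast
      \<comment> \<open>The product of the four new generators is again \<open>\<omega>\<close>, and \<open>\<omega> \<omega> f = f\<close>.\<close>
      then have "\<omega> (a (\<omega> (b (\<omega> (c (\<omega> (d (\<omega> (f s))))))))) = f s"
        using f by (auto simp: \<omega> rules)
      then show ?thesis
        using U(3)[OF _ U(3)[OF _ U(3)[OF _ U(3)[OF _ U(3)[OF f \<open>s \<in> U\<close>]]]], of a b c d] by simp
    qed
    then have "\<forall>\<delta> f. (\<delta>, f) \<in> set ?old \<longrightarrow> (\<forall>s\<in>U. f s \<in> U)"
      using U(4) old_mem by meson
    then show ?thesis
      using irr U(1,2) unfolding irreducible_family_def by blast
  qed
  show "irreducible_family W ?new"
    unfolding irreducible_family_def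
  proof (intro conjI new allI impI)
    show "W \<noteq> {0}" using irr unfolding irreducible_family_def by blast
    fix U assume U: "subspace U \<and> U \<subseteq> W \<and> (\<forall>\<epsilon> f. (\<epsilon>, f) \<in> set ?new \<longrightarrow> (\<forall>s\<in>U. f s \<in> U))"
    show "U = {0} \<or> U = W"
    proof (rule inv)
      show "\<omega> (f s) \<in> U" if "f \<in> {a, b, c, d}" "s \<in> U" for f s
      proof -
        have "(1, \<omega> \<circ> f) \<in> set ?new" using that(1) by auto
        then have "(\<omega> \<circ> f) s \<in> U" using U that(2) by blast
        then show ?thesis by simp
      qed
      show "g s \<in> U" if "(\<delta>, g) \<in> set ?R" "s \<in> U" for \<delta> g s
      proof -
        have "(\<delta>, g) \<in> set ?new" using that(1) by auto
        then show ?thesis using U that(2) by blast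
      qed
    qed (use U in blast)+
  qed
  show "real_type_vector W ?old s0" if s0: "real_type_vector W ?new s0"
    unfolding real_type_vector_def
  proof (intro conjI allI impI)
    show "s0 \<in> W" "s0 \<noteq> 0" using s0 unfolding real_type_vector_def by blast+
  next
    fix C assume C: "linear C \<and> (\<forall>s\<in>W. C s \<in> W) \<and>
      (\<forall>\<delta> f. (\<delta>, f) \<in> set ?old \<longrightarrow> (\<forall>s\<in>W. C (f s) = f (C s)))"
    then have c: "C (a s) = a (C s)" "C (b s) = b (C s)" "C (c s) = c (C s)" "C (d s) = d (C s)"
      if "s \<in> W" for s
      using that ins by blast+
    have "C ((\<omega> \<circ> f) s) = (\<omega> \<circ> f) (C s)" if "f \<in> {a, b, c, d}" "s \<in> W" for f s
      using that(1) by (auto simp: \<omega> c mem that(2))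
    moreover have "C (g s) = g (C s)" if "(\<delta>, g) \<in> set ?R" "s \<in> W" for \<delta> g s
    proof -
      have "(\<delta>, g) \<in> set ?old" using that(1) by auto
      then show ?thesis using C that(2) by blast
    qed
    ultimately have "\<forall>\<delta> f. (\<delta>, f) \<in> set ?new \<longrightarrow> (\<forall>s\<in>W. C (f s) = f (C s))"
      using new_mem by metis
    moreover have "linear C" "\<forall>s\<in>W. C s \<in> W" using C by blast+
    ultimately show "\<exists>r. C s0 = r *\<^sub>R s0" by (intro real_type_vector_commutant[OF s0])
  next
    fix \<beta> :: "'a \<Rightarrow> 'a \<Rightarrow> real"
    assume \<beta>: "bilinear \<beta> \<and> (\<forall>s\<in>W. \<forall>t\<in>W. \<beta> s t = - \<beta> t s) \<and>
      (\<forall>\<delta> f. (\<delta>, f) \<in> set ?old \<longrightarrow> (\<forall>s\<in>W. \<forall>t\<in>W. \<beta> (f s) t = \<delta> * \<beta> s (f t)))"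
    then have bil: "bilinear \<beta>" by blast
    have b: "\<beta> (a s) t = (-1) * \<beta> s (a t)" "\<beta> (b s) t = (-1) * \<beta> s (b t)"
      "\<beta> (c s) t = (-1) * \<beta> s (c t)" "\<beta> (d s) t = (-1) * \<beta> s (d t)"
      if "s \<in> W" "t \<in> W" for s t
      using \<beta> that ins by blast+
    have "\<beta> ((\<omega> \<circ> f) s) t = 1 * \<beta> s ((\<omega> \<circ> f) t)" if "f \<in> {a, b, c, d}" "s \<in> W" "t \<in> W" for f s t
      using that(1) by (auto simp: \<omega> b rules that(2,3) bilinear_rneg[OF bil] bilinear_lneg[OF bil])
    moreover have "\<beta> (g s) t = \<delta> * \<beta> s (g t)" if "(\<delta>, g) \<in> set ?R" "s \<in> W" "t \<in> W" for \<delta> g s t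
    proof -
      have "(\<delta>, g) \<in> set ?old" using that(1) by auto
      then show ?thesis using \<beta> that(2,3) by blast
    qed
    ultimately have "\<forall>\<delta> f. (\<delta>, f) \<in> set ?new \<longrightarrow> (\<forall>s\<in>W. \<forall>t\<in>W. \<beta> (f s) t = \<delta> * \<beta> s (f t))"
      using new_mem by metis
    moreover have "\<forall>s\<in>W. \<forall>t\<in>W. \<beta> s t = - \<beta> t s" using \<beta> by (elim conjE)
    ultimately show "\<forall>t\<in>W. \<beta> s0 t = 0" by (intro real_type_vector_form[OF s0 bil])
  qed
qed

text \<open>Eight negative generators can be removed: flip four of them and split off the four pairs of
signs \<open>(+, -)\<close>. Such a pair does not change the signs of the generators that remain. Once none is
left, irreducibility says that \<open>W\<close> is a line, and on a line every operator is scalar and every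
alternating form is zero.\<close>

lemma real_type_negative:
  fixes L :: "(real \<times> ('s::real_vector \<Rightarrow> 's)) list"
  assumes "\<forall>x\<in>set L. fst x = -1" "length L = 8 * k"
  shows "real_type L"
  using assms
proof (induction k arbitrary: L)
  case 0
  show ?case
    unfolding real_type_def
  proof (intro allI impI)
    fix W assume "irreducible_family W L"
    then have W: "subspace W" "W \<noteq> {0}"
      and min: "\<And>U. subspace U \<Longrightarrow> U \<subseteq> W \<Longrightarrow> U = {0} \<or> U = W"
      using 0 unfolding irreducible_family_def clifford_family_def by auto
    obtain s0 where s0: "s0 \<in> W" "s0 \<noteq> 0" using W subspace_0 by blast
    have "span {s0} \<subseteq> W" using s0 W by (simp add: span_minimal)
    moreover have "span {s0} \<noteq> {0}" using s0 span_base[of s0 "{s0}"] by blast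
    ultimately have Ws0: "W = span {s0}" using min[of "span {s0}"] by simp
    have mult: "\<exists>r. t = r *\<^sub>R s0" if "t \<in> W" for t
      using that unfolding Ws0 span_singleton by blast
    have "real_type_vector W L s0"
      unfolding real_type_vector_def
    proof (intro conjI s0 allI impI ballI)
      fix C assume "linear C \<and> (\<forall>s\<in>W. C s \<in> W) \<and>
        (\<forall>\<delta> f. (\<delta>, f) \<in> set L \<longrightarrow> (\<forall>s\<in>W. C (f s) = f (C s)))"
      then show "\<exists>r. C s0 = r *\<^sub>R s0" using mult s0 by blast
    next
      fix \<beta> :: "'s \<Rightarrow> 's \<Rightarrow> real" and t
      assume \<beta>: "bilinear \<beta> \<and> (\<forall>s\<in>W. \<forall>t\<in>W. \<beta> s t = - \<beta> t s) \<and>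
        (\<forall>\<delta> f. (\<delta>, f) \<in> set L \<longrightarrow> (\<forall>s\<in>W. \<forall>t\<in>W. \<beta> (f s) t = \<delta> * \<beta> s (f t)))"
        and "t \<in> W"
      then have "\<beta> s0 s0 = - \<beta> s0 s0" and bil: "bilinear \<beta>" using s0 by blast+
      then show "\<beta> s0 t = 0"
        using mult[OF \<open>t \<in> W\<close>] bilinear_rmul[OF bil] by fastforce
    qed
    then show "\<exists>s0. real_type_vector W L s0" ..
  qed
next
  case (Suc k)
  obtain a x b y c z d w L' where "L = a # x # b # y # c # z # d # w # L'" and k: "length L' = 8 * k"
    using Suc.prems(2) by (auto simp: length_Suc_conv numeral_eq_Suc)
  then obtain a x b y c z d w where
    L: "L = (-1, a) # (-1, x) # (-1, b) # (-1, y) # (-1, c) # (-1, z) # (-1, d) # (-1, w) # L'"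
    and neg: "\<forall>x\<in>set L'. fst x = -1"
    using Suc.prems(1) by (cases a; cases x; cases b; cases y; cases c; cases z; cases d; cases w) auto
  define \<omega> where "\<omega> = a \<circ> b \<circ> c \<circ> d"
  have "real_type ((1, \<omega> \<circ> a) # (-1, x) # (1, \<omega> \<circ> b) # (-1, y) # (1, \<omega> \<circ> c) #
      (-1, z) # (1, \<omega> \<circ> d) # (-1, w) # L')"
    by ((rule real_type_step,
          simp only: list.map prod.case minus_minus mult_1_left mult_1_right map_map)+,
        rule Suc.IH) (use neg k in auto)
  then show ?case
    using flip_four[OF _ \<omega>_def] unfolding L real_type_def by blast
qed

text \<open>Splitting off a pair of signs \<open>(+, +)\<close> turns all remaining generators negative. After the
first pair, a multiple of 8 generators is left.\<close>

lemma real_type_positive: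
  fixes L :: "(real \<times> ('s::real_vector \<Rightarrow> 's)) list"
  assumes "\<forall>x\<in>set L. fst x = 1" "length L mod 8 = 2"
  shows "real_type L"
proof -
  obtain k where "length L = Suc (Suc (8 * k))"
    using assms(2) by (metis add.commute add_2_eq_Suc mod_div_mult_eq mult.commute)
  then obtain a b L' where "L = a # b # L'" and k: "length L' = 8 * k"
    by (auto simp: length_Suc_conv)
  then obtain p q where L: "L = (1, p) # (1, q) # L'" and pos: "\<forall>x\<in>set L'. fst x = 1"
    using assms(1) by (cases a; cases b) auto
  show ?thesis unfolding L
    by (rule real_type_step, rule real_type_negative[of _ k]) (use pos k in auto)
qed

section \<open>The volume element of a Clifford module\<close>

locale euclidean_clifford_module =
  fixes c :: "'a::euclidean_space \<Rightarrow> 's::real_vector \<Rightarrow> 's"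
  assumes clifford: "clifford_module neg_inner c"
begin

lemma bilinear_c: "bilinear c"
  using clifford unfolding clifford_module_def by blast

lemmas c_simps =
  bilinear_ladd[OF bilinear_c] bilinear_radd[OF bilinear_c] bilinear_lmul[OF bilinear_c]
  bilinear_rmul[OF bilinear_c] bilinear_lneg[OF bilinear_c] bilinear_rneg[OF bilinear_c]
  bilinear_lzero[OF bilinear_c] bilinear_rzero[OF bilinear_c]
  bilinear_lsub[OF bilinear_c] bilinear_rsub[OF bilinear_c]

lemma linear_c: "linear (c v)"
  using bilinear_c unfolding bilinear_def by blast

lemma c_square: "c v (c v s) = (v \<bullet> v) *\<^sub>R s"
  using clifford unfolding clifford_module_def neg_inner_def by simp

lemma c_anticommutator: "c v (c w s) + c w (c v s) = (2 * (v \<bullet> w)) *\<^sub>R s"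
proof -
  have "c (v + w) (c (v + w) s) = ((v + w) \<bullet> (v + w)) *\<^sub>R s" by (rule c_square)
  then show ?thesis
    by (simp add: c_simps c_square inner_simps inner_commute algebra_simps)
qed

lemma c_orthogonal: "v \<bullet> w = 0 \<Longrightarrow> c v (c w s) = - c w (c v s)"
  using c_anticommutator[of v w s] by (simp add: eq_neg_iff_add_eq_0)

lemma volume_Nil: "volume_action c [] s = s"
  and volume_Cons: "volume_action c (e # es) s = c e (volume_action c es s)"
  by (simp_all add: volume_action_def)

lemma linear_volume: "linear (volume_action c es)"
proof (induction es)
  case (Cons e es)
  then show ?case
    by (intro linearI) (simp_all add: volume_Cons c_simps linear_add linear_scale)
qed (simp add: linear_iff volume_Nil)

lemma volume_orthogonal:
  assumes "\<And>w. w \<in> set es \<Longrightarrow> v \<bullet> w = 0"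
  shows "c v (volume_action c es s) = (- 1) ^ length es *\<^sub>R volume_action c es (c v s)"
  using assms by (induction es) (simp_all add: volume_Nil volume_Cons c_simps c_orthogonal)

lemma volume_member:
  assumes "sorted_wrt (\<lambda>v w. v \<bullet> w = 0) es" "\<And>w. w \<in> set es \<Longrightarrow> w \<bullet> w = 1" "v \<in> set es"
  shows "c v (volume_action c es s) = - ((- 1) ^ length es) *\<^sub>R volume_action c es (c v s)"
  using assms
proof (induction es)
  case (Cons e es)
  show ?case
  proof (cases "v = e")
    case True
    then have "volume_action c es (c e s) = (- 1) ^ length es *\<^sub>R c e (volume_action c es s)"
      using volume_orthogonal[of es e s] Cons.prems by simp
    then show ?thesis using True by (simp add: volume_Cons c_simps c_square)
  next
    case False
    then have v: "v \<in> set es" and "e \<bullet> v = 0" using Cons.prems by auto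
    then have "c v (c e t) = - c e (c v t)" for t
      by (intro c_orthogonal) (simp add: inner_commute)
    then show ?thesis using Cons v by (simp add: volume_Cons c_simps)
  qed
qed simp

text \<open>Moving the \<open>n\<close> factors of the second copy past the first one costs one sign for each pair of distinct
vectors.\<close>

lemma volume_square:
  assumes "sorted_wrt (\<lambda>v w. v \<bullet> w = 0) es" "\<And>w. w \<in> set es \<Longrightarrow> w \<bullet> w = 1"
  shows "volume_action c es (volume_action c es s) = (- 1) ^ (length es choose 2) *\<^sub>R s"
  using assms
proof (induction es arbitrary: s)
  case (Cons e es)
  have V: "volume_action c es (c e t) = (- 1) ^ length es *\<^sub>R c e (volume_action c es t)" for t
    using volume_orthogonal[of es e t] Cons.prems by simp
  show ?case
    using Cons by (simp add: volume_Cons V c_simps c_square power_add numeral_2_eq_2)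
qed (simp add: volume_Nil numeral_2_eq_2)

text \<open>The adjoint of a product of \<open>n\<close> skew operators is \<open>(-1)\<^sup>n\<close> times the reversed product, and reversing
anticommuting factors costs one sign per pair.\<close>

lemma volume_skew_form:
  assumes "bilinear \<beta>" "\<And>v s t. \<beta> (c v s) t = - \<beta> s (c v t)"
    and "sorted_wrt (\<lambda>v w. v \<bullet> w = 0) es"
  shows "\<beta> (volume_action c es s) t =
    (- 1) ^ (length es + (length es choose 2)) * (\<beta> s (volume_action c es t) :: real)"
  using assms(3)
proof (induction es arbitrary: s t)
  case (Cons e es)
  have V: "volume_action c es (c e t) = (- 1) ^ length es *\<^sub>R c e (volume_action c es t)" for t
    using volume_orthogonal[of es e t] Cons.prems by simp
  show ?case
    using Cons assms(2)
    by (simp add: volume_Cons V power_add numeral_2_eq_2 bilinear_rmul[OF assms(1)])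
qed (simp add: volume_Nil numeral_2_eq_2)

end

lemma orthonormal_frame_nth:
  assumes "orthonormal_frame es" "i < length es" "j < length es"
  shows "es ! i \<bullet> es ! j = (if i = j then 1 else 0)"
proof -
  have "neg_inner (es ! i) (es ! j) = (if i = j then - 1 else 0)"
    using assms unfolding orthonormal_frame_def by blast
  then show ?thesis unfolding neg_inner_def by (simp split: if_splits)
qed

lemma orthonormal_frame_inner:
  assumes "orthonormal_frame es"
  shows "sorted_wrt (\<lambda>v w. v \<bullet> w = 0) es" "\<And>w. w \<in> set es \<Longrightarrow> w \<bullet> w = 1"
  unfolding sorted_wrt_iff_nth_less
  by (auto simp: in_set_conv_nth orthonormal_frame_nth[OF assms])

lemma span_orthonormal_frame:
  assumes "orthonormal_frame (es :: 'a::euclidean_space list)"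
  shows "span (set es) = UNIV"
proof -
  note in0 = orthonormal_frame_nth[OF assms]
  have "distinct es"
    unfolding distinct_conv_nth using in0 by (metis zero_neq_one)
  then have "card (set es) = DIM('a)"
    using assms unfolding orthonormal_frame_def by (simp add: distinct_card)
  moreover have "pairwise orthogonal (set es)"
    unfolding pairwise_def orthogonal_def by (auto simp: in_set_conv_nth in0)
  then have "independent (set es)"
    using orthonormal_frame_inner(2)[OF assms, of 0] by (intro pairwise_orthogonal_independent) auto
  ultimately show ?thesis
    using card_ge_dim_independent[of "set es" UNIV] by auto
qed

section \<open>Irreducible modules of real type\<close>

locale real_clifford_module = euclidean_clifford_module c
  for c :: "'a::euclidean_space \<Rightarrow> 's::real_vector \<Rightarrow> 's" +
  fixes es :: "'a list"
  assumes irreducible: "irreducible_clifford_module neg_inner c"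
    and dim: "DIM('a) mod 8 = 2"
    and frame: "orthonormal_frame es"
begin

definition J :: "'s \<Rightarrow> 's"
  where "J = volume_action c es"

lemma linear_J: "linear J"
  unfolding J_def by (rule linear_volume)

text \<open>These two parities make \<open>J\<close> anticommute with vectors and square to \<open>-1\<close>.\<close>

lemma sign_exponents: "even (length es)" "odd (length es choose 2)"
proof -
  have "length es mod 8 = 2" using dim frame unfolding orthonormal_frame_def by simp
  then obtain k where k: "length es = 8 * k + 2" by (metis mult_div_mod_eq)
  then show "even (length es)" by simp
  have "length es choose 2 = (4 * k + 1) * (8 * k + 1)"
    unfolding k choose_two by simp
  then show "odd (length es choose 2)" by simp
qed

lemma J_square: "J (J s) = - s"
  using volume_square[OF orthonormal_frame_inner[OF frame]] sign_exponents unfolding J_def by simp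

lemma J_anticommutes: "c v (J s) = - J (c v s)"
proof -
  have "subspace {v. \<forall>s. c v (J s) = - J (c v s)}"
    by (auto simp: subspace_def c_simps linear_0[OF linear_J] linear_add[OF linear_J]
        linear_scale[OF linear_J])
  moreover have "set es \<subseteq> {v. \<forall>s. c v (J s) = - J (c v s)}"
    using volume_member[OF orthonormal_frame_inner[OF frame]] sign_exponents unfolding J_def by auto
  ultimately have "span (set es) \<subseteq> {v. \<forall>s. c v (J s) = - J (c v s)}" by (simp add: span_minimal)
  then show ?thesis using span_orthonormal_frame[OF frame] by auto
qed

lemma c_invariant_subspace:
  assumes "subspace W" "\<And>e s. e \<in> set es \<Longrightarrow> s \<in> W \<Longrightarrow> c e s \<in> W"
  shows "W = {0} \<or> W = UNIV"
proof -
  have "subspace {v. \<forall>s\<in>W. c v s \<in> W}"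
    using assms(1) by (auto simp: subspace_def c_simps)
  moreover have "set es \<subseteq> {v. \<forall>s\<in>W. c v s \<in> W}" using assms(2) by blast
  ultimately have "span (set es) \<subseteq> {v. \<forall>s\<in>W. c v s \<in> W}" by (simp add: span_minimal)
  then have "\<forall>v. \<forall>s\<in>W. c v s \<in> W" using span_orthonormal_frame[OF frame] by blast
  then show ?thesis
    using irreducible assms(1) unfolding irreducible_clifford_module_def by blast
qed

lemma real_type_vector_exists:
  obtains s0 where "real_type_vector UNIV (map (\<lambda>e. (1, c e)) es) s0"
proof -
  have fam: "clifford_family UNIV (map (\<lambda>e. (1, c e)) es)"
    unfolding clifford_family_def sorted_wrt_map
  proof (intro conjI)
    show "sorted_wrt (\<lambda>x y. anticommute_on UNIV (snd (1, c x)) (snd (1, c y))) es"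
      by (rule sorted_wrt_mono_rel[OF _ orthonormal_frame_inner(1)[OF frame]])
        (simp add: anticommute_on_def c_orthogonal)
  qed (auto simp: linear_c c_square orthonormal_frame_inner(2)[OF frame])
  have min: "U = {0} \<or> U = UNIV"
    if U: "subspace U" "\<forall>\<epsilon> f. (\<epsilon>, f) \<in> set (map (\<lambda>e. (1, c e)) es) \<longrightarrow> (\<forall>s\<in>U. f s \<in> U)" for U
    using U by (intro c_invariant_subspace) auto
  have nz: "(UNIV :: 's set) \<noteq> {0}"
    using irreducible unfolding irreducible_clifford_module_def by blast
  have "irreducible_family UNIV (map (\<lambda>e. (1, c e)) es)"
    unfolding irreducible_family_def by (intro conjI allI impI fam nz, elim conjE) (rule min)
  moreover have "real_type (map (\<lambda>e. (1, c e)) es)"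
    using dim frame unfolding orthonormal_frame_def by (intro real_type_positive) auto
  ultimately show ?thesis using that unfolding real_type_def by blast
qed

text \<open>Schur's lemma: an operator in the commutant has an eigenvector, and the eigenspace is a submodule.\<close>

lemma commutant_real:
  assumes C: "linear C" "\<And>v s. C (c v s) = c v (C s)"
  shows "\<exists>r. \<forall>s. C s = r *\<^sub>R s"
proof -
  obtain s0 where s0: "real_type_vector UNIV (map (\<lambda>e. (1, c e)) es) s0"
    by (rule real_type_vector_exists)
  have "\<exists>r. C s0 = r *\<^sub>R s0"
    by (rule real_type_vector_commutant[OF s0 C(1)]) (auto simp: C(2))
  then obtain r where r: "C s0 = r *\<^sub>R s0" ..
  have "subspace {s. C s = r *\<^sub>R s}"
    using C(1) by (auto simp: subspace_def linear_0 linear_add linear_scale scaleR_add_right)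
  then have "{s. C s = r *\<^sub>R s} = {0} \<or> {s. C s = r *\<^sub>R s} = UNIV"
    by (rule c_invariant_subspace) (simp add: C(2) c_simps)
  moreover have "s0 \<noteq> 0" using s0 unfolding real_type_vector_def by blast
  ultimately show ?thesis using r by blast
qed

text \<open>The radical is a submodule and contains a nonzero vector.\<close>

lemma alternating_form_zero:
  fixes \<beta> :: "'s \<Rightarrow> 's \<Rightarrow> real"
  assumes bil: "bilinear \<beta>" and alt: "\<And>s t. \<beta> s t = - \<beta> t s"
    and sym: "\<And>v s t. \<beta> (c v s) t = \<beta> s (c v t)"
  shows "\<beta> s t = 0"
proof -
  obtain s0 where s0: "real_type_vector UNIV (map (\<lambda>e. (1, c e)) es) s0"
    by (rule real_type_vector_exists)
  have "\<forall>t\<in>UNIV. \<beta> s0 t = 0"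
    by (rule real_type_vector_form[OF s0 bil]) (use alt in blast, auto simp: sym)
  moreover have "subspace {s. \<forall>t. \<beta> s t = 0}"
    by (auto simp: subspace_def bilinear_ladd[OF bil] bilinear_lmul[OF bil] bilinear_lzero[OF bil])
  then have "{s. \<forall>t. \<beta> s t = 0} = {0} \<or> {s. \<forall>t. \<beta> s t = 0} = UNIV"
    by (rule c_invariant_subspace) (simp add: sym)
  moreover have "s0 \<noteq> 0" using s0 unfolding real_type_vector_def by blast
  ultimately show ?thesis by blast
qed

text \<open>The twisted form \<open>\<beta>(J s, t)\<close> is alternating, because \<open>J\<close> is skew for \<open>\<beta>\<close>, and vectors act
symmetrically on it, because they anticommute with \<open>J\<close>.\<close>

lemma symmetric_form_zero:
  fixes \<beta> :: "'s \<Rightarrow> 's \<Rightarrow> real"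
  assumes bil: "bilinear \<beta>" and sym: "\<And>s t. \<beta> s t = \<beta> t s"
    and skew: "\<And>v s t. \<beta> (c v s) t = - \<beta> s (c v t)"
  shows "\<beta> s t = 0"
proof -
  have J: "\<beta> (J s) t = - \<beta> s (J t)" for s t
    using volume_skew_form[OF bil skew orthonormal_frame_inner(1)[OF frame]] sign_exponents
    unfolding J_def by simp
  have "\<beta> (J s) t = 0" for s t
  proof (rule alternating_form_zero[of "\<lambda>s t. \<beta> (J s) t"])
    show "bilinear (\<lambda>s t. \<beta> (J s) t)"
      using bil linear_compose[OF linear_J] unfolding bilinear_def comp_def by blast
    show "\<beta> (J s) t = - \<beta> (J t) s" for s t using J[of s t] sym[of s "J t"] by simp
    show "\<beta> (J (c v s)) t = \<beta> (J s) (c v t)" for v s t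
      using skew[of v "J s" t] by (simp add: J_anticommutes bilinear_lneg[OF bil])
  qed
  from this[of "J s"] show ?thesis by (simp add: J_square bilinear_lneg[OF bil])
qed

text \<open>Replacing both arguments by their Clifford multiples shows that the hypothesis also holds in the form
\<open>\<beta>(s, v t) = - \<beta>(t, v s)\<close>. Adding and subtracting the two versions, vectors are skew for the
symmetric part of \<open>\<beta>\<close> and symmetric for its alternating part.\<close>

lemma exchange_skew_form_zero:
  fixes \<beta> :: "'s \<Rightarrow> 's \<Rightarrow> real"
  assumes bil: "bilinear \<beta>" and ex: "\<And>v s t. \<beta> (c v s) t = - \<beta> (c v t) s"
  shows "\<beta> s t = 0"
proof -
  have flip: "bilinear (\<lambda>s t. \<beta> t s)" using bil unfolding bilinear_def by blast
  have ex': "\<beta> s (c v t) = - \<beta> t (c v s)" for v s t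
  proof (cases "v = 0")
    case False
    have "(v \<bullet> v) * (\<beta> s (c v t) + \<beta> t (c v s)) = 0"
      using ex[of v "c v s" "c v t"] by (simp add: c_square bilinear_lmul[OF bil] distrib_left)
    then show ?thesis using False by (simp add: eq_neg_iff_add_eq_0)
  qed (simp add: c_simps bilinear_rzero[OF bil])
  have "\<beta> s t + \<beta> t s = 0"
  proof (rule symmetric_form_zero[of "\<lambda>s t. \<beta> s t + \<beta> t s"])
    show "bilinear (\<lambda>s t. \<beta> s t + \<beta> t s)"
      using bil flip unfolding bilinear_def by (auto intro: linear_compose_add)
    show "\<beta> (c v s) t + \<beta> t (c v s) = - (\<beta> s (c v t) + \<beta> (c v t) s)" for v s t
      using ex[of v s t] ex'[of s v t] by simp
  qed simp
  moreover have "\<beta> s t - \<beta> t s = 0"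
  proof (rule alternating_form_zero[of "\<lambda>s t. \<beta> s t - \<beta> t s"])
    show "bilinear (\<lambda>s t. \<beta> s t - \<beta> t s)"
      using bil flip unfolding bilinear_def by (auto intro: linear_compose_sub)
    show "\<beta> (c v s) t - \<beta> t (c v s) = \<beta> s (c v t) - \<beta> (c v t) s" for v s t
      using ex[of v s t] ex'[of s v t] by simp
  qed simp
  ultimately show ?thesis by simp
qed

text \<open>The intertwining relation also holds with \<open>C\<close> and \<open>D\<close> exchanged. So \<open>C + D\<close> commutes with vectors,
whereas \<open>C - D\<close> anticommutes with them and becomes an element of the commutant after
multiplication by \<open>J\<close>.\<close>

lemma intertwining_pair:
  assumes lin: "linear C" "linear D" and CD: "\<And>v s. C (c v s) = c v (D s)"
  obtains a b where "\<And>s. C s = a *\<^sub>R s + b *\<^sub>R J s" "\<And>s. D s = a *\<^sub>R s - b *\<^sub>R J s"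
proof -
  have DC: "D (c v s) = c v (C s)" for v s
  proof (cases "v = 0")
    case False
    have "(v \<bullet> v) *\<^sub>R c v (C s) = (v \<bullet> v) *\<^sub>R D (c v s)"
      using arg_cong[OF CD[of v "c v s"], of "c v"] lin by (simp add: c_square linear_scale c_simps)
    then have "c v (C s) = D (c v s)" using False by simp
    then show ?thesis ..
  qed (use lin in \<open>simp add: c_simps linear_0\<close>)
  have "\<exists>r. \<forall>s. C s + D s = r *\<^sub>R s"
    using lin by (intro commutant_real) (auto intro: linear_compose_add simp: CD DC c_simps)
  then obtain a where a: "\<And>s. C s + D s = a *\<^sub>R s" by blast
  have "\<exists>r. \<forall>s. C (J s) - D (J s) = r *\<^sub>R s"
  proof (rule commutant_real)
    show "linear (\<lambda>s. C (J s) - D (J s))"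
      using linear_compose_sub linear_compose[OF linear_J lin(1)] linear_compose[OF linear_J lin(2)]
      unfolding comp_def by blast
    show "C (J (c v s)) - D (J (c v s)) = c v (C (J s) - D (J s))" for v s
    proof -
      have "J (c v s) = - c v (J s)" by (simp add: J_anticommutes)
      then show ?thesis using lin by (simp add: linear_neg CD DC c_simps)
    qed
  qed
  then obtain b where b: "\<And>s. C (J s) - D (J s) = b *\<^sub>R s" by blast
  have d: "C s - D s = (- b) *\<^sub>R J s" for s
    using b[of "J s"] lin by (simp add: J_square linear_neg algebra_simps)
  have "2 *\<^sub>R C s = a *\<^sub>R s + (- b) *\<^sub>R J s" "2 *\<^sub>R D s = a *\<^sub>R s - (- b) *\<^sub>R J s" for s
    unfolding a[symmetric] d[symmetric] by (simp_all add: scaleR_2)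
  then have "(1/2) *\<^sub>R 2 *\<^sub>R C s = (1/2) *\<^sub>R (a *\<^sub>R s + (- b) *\<^sub>R J s)"
    "(1/2) *\<^sub>R 2 *\<^sub>R D s = (1/2) *\<^sub>R (a *\<^sub>R s - (- b) *\<^sub>R J s)" for s by simp_all
  then show ?thesis
    by (intro that[of "a / 2" "- b / 2"]) (simp_all add: algebra_simps)
qed

text \<open>Linear independence of \<open>Id\<close> and \<open>J\<close>, which makes conjugation well-defined on their span.\<close>

lemma scalar_J_unique:
  assumes "\<And>s. a *\<^sub>R s + b *\<^sub>R J s = a' *\<^sub>R s + b' *\<^sub>R J s"
  shows "a = a'" "b = b'"
proof -
  obtain s :: 's where "s \<noteq> 0"
    using irreducible unfolding irreducible_clifford_module_def by blast
  define x where "x = a - a'"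
  define y where "y = b - b'"
  have *: "x *\<^sub>R s + y *\<^sub>R J s = 0" for s
    using assms[of s] unfolding x_def y_def by (simp add: algebra_simps)
  have "x *\<^sub>R (x *\<^sub>R s + y *\<^sub>R J s) - y *\<^sub>R (x *\<^sub>R J s + y *\<^sub>R J (J s)) = (x * x + y * y) *\<^sub>R s"
    by (simp add: J_square algebra_simps)
  then have "(x * x + y * y) *\<^sub>R s = 0" using * by simp
  then have "x * x + y * y = 0" using \<open>s \<noteq> 0\<close> by simp
  then show "a = a'" "b = b'" unfolding x_def y_def by (simp_all add: sum_squares_eq_zero_iff)
qed

lemma schur_conj_eq: "schur_conj J (\<lambda>s. a *\<^sub>R s + b *\<^sub>R J s) = (\<lambda>s. a *\<^sub>R s - b *\<^sub>R J s)"
  unfolding schur_conj_def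
proof (rule the_equality)
  fix D assume "\<exists>a' b'. (\<lambda>s. a *\<^sub>R s + b *\<^sub>R J s) = (\<lambda>s. a' *\<^sub>R s + b' *\<^sub>R J s) \<and>
    D = (\<lambda>s. a' *\<^sub>R s - b' *\<^sub>R J s)"
  then obtain a' b' where eq: "\<And>s. a *\<^sub>R s + b *\<^sub>R J s = a' *\<^sub>R s + b' *\<^sub>R J s"
    and D: "D = (\<lambda>s. a' *\<^sub>R s - b' *\<^sub>R J s)" by metis
  have "a = a'" "b = b'" by (rule scalar_J_unique[OF eq])+
  then show "D = (\<lambda>s. a *\<^sub>R s - b *\<^sub>R J s)" using D by simp
qed blast

lemma scalar_J_in_schur_algebra: "(\<lambda>s. a *\<^sub>R s + b *\<^sub>R J s) \<in> schur_algebra c"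
proof -
  have "linear (\<lambda>s. a *\<^sub>R s + b *\<^sub>R J s)"
    using linear_J by (intro linearI) (simp_all add: linear_add linear_scale algebra_simps)
  moreover have "J (spin_action c v w s) = spin_action c v w (J s)" for v w s
    by (simp add: spin_action_def J_anticommutes linear_scale[OF linear_J] linear_diff[OF linear_J]
        c_simps)
  moreover have "spin_action c v w (x *\<^sub>R s + y *\<^sub>R t) =
      x *\<^sub>R spin_action c v w s + y *\<^sub>R spin_action c v w t" for v w s t x y
    by (simp add: spin_action_def c_simps algebra_simps)
  ultimately show ?thesis unfolding schur_algebra_def by (auto simp: comp_def)
qed

text \<open>Invariance reads \<open>2 a \<gamma>(s, t) = b (\<gamma>(J s, t) + \<gamma>(s, J t))\<close>. The right side changes sign when \<open>J\<close> is
applied to both arguments, so if \<open>a \<noteq> 0\<close> then \<open>\<gamma>\<close> would be anti-hermitian; substituting this back gives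
\<open>(a\<^sup>2 + b\<^sup>2) \<gamma> = 0\<close>. With \<open>a = 0\<close> the relation says that \<open>J\<close> is skew for \<open>\<gamma>\<close>, which is hermitian
symmetry as \<open>J\<^sup>2 = -1\<close>.\<close>

lemma invariant_form_hermitian:
  fixes \<gamma> :: "'s \<Rightarrow> 's \<Rightarrow> real"
  assumes bil: "bilinear \<gamma>" and "\<gamma> s0 t0 \<noteq> 0"
    and inv: "\<And>s t. \<gamma> (a *\<^sub>R s - b *\<^sub>R J s) t + \<gamma> s (a *\<^sub>R t - b *\<^sub>R J t) = 0"
  shows "a = 0" and "b \<noteq> 0 \<Longrightarrow> J_hermitian J \<gamma>"
proof -
  note simps = bilinear_lsub[OF bil] bilinear_rsub[OF bil] bilinear_lmul[OF bil]
    bilinear_rmul[OF bil] bilinear_lneg[OF bil] bilinear_rneg[OF bil] J_square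
  have H: "2 * a * \<gamma> s t = b * (\<gamma> (J s) t + \<gamma> s (J t))" for s t
    using inv[of s t] by (simp add: simps algebra_simps)
  show "a = 0"
  proof (rule ccontr)
    assume "a \<noteq> 0"
    define g h k where "g = \<gamma> s0 t0" and "h = \<gamma> (J s0) (J t0)"
      and "k = \<gamma> (J s0) t0 + \<gamma> s0 (J t0)"
    have 1: "2 * a * g = b * k" using H[of s0 t0] unfolding g_def k_def .
    have "2 * a * h = - (b * k)" using H[of "J s0" "J t0"] unfolding h_def k_def
      by (simp add: simps algebra_simps)
    then have "a * (h + g) = 0" using 1 by (simp add: algebra_simps)
    then have 2: "h = - g" using \<open>a \<noteq> 0\<close> by (simp add: eq_neg_iff_add_eq_0)
    have "2 * a * k = 2 * b * (h - g)"
      using H[of "J s0" t0] H[of s0 "J t0"] unfolding g_def h_def k_def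
      by (simp add: simps algebra_simps)
    then have "a * k = - 2 * b * g" using 2 by simp
    then have "- 2 * b\<^sup>2 * g = b * (a * k)" by (simp add: power2_eq_square)
    also have "\<dots> = a * (b * k)" by (rule mult.left_commute)
    also have "\<dots> = 2 * a\<^sup>2 * g" unfolding 1[symmetric] by (simp add: power2_eq_square)
    finally have "(a\<^sup>2 + b\<^sup>2) * g = 0" unfolding distrib_right by linarith
    moreover have "a\<^sup>2 + b\<^sup>2 \<noteq> 0" using \<open>a \<noteq> 0\<close> by (simp only: sum_power2_eq_zero_iff simp_thms)
    ultimately have "g = 0" unfolding mult_eq_0_iff by blast
    then show False using assms(2) unfolding g_def by contradiction
  qed
  show "J_hermitian J \<gamma>" if "b \<noteq> 0"
    unfolding J_hermitian_def
  proof (intro conjI bil allI)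
    fix s t
    have "\<gamma> (J s) (J t) + \<gamma> s (J (J t)) = 0" using H[of s "J t"] \<open>a = 0\<close> that by simp
    then show "\<gamma> (J s) (J t) = \<gamma> s t" by (simp add: simps)
  qed
qed

end

section \<open>Zero charge spin representations of the Heisenberg algebra\<close>

lemma inv_flat_zero: "inv flat 0 = (0 :: 'a::euclidean_space)"
proof -
  have "flat 0 = (0 :: 'a \<Rightarrow>\<^sub>L real)"
    by (rule blinfun_eqI) (simp add: blinfun_apply_flat neg_inner_def)
  then show ?thesis by (metis inv_f_f bij_is_inj bij_flat)
qed

lemma heis_p_central: "bilinear b \<Longrightarrow> heis_bracket b x heis_p = 0"
  by (cases x) (simp add: heis_p_def inv_flat_zero bilinear_lzero bilinear_rzero zero_prod_def)

lemma form_endo: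
  fixes b :: "'a::euclidean_space \<Rightarrow> 'a \<Rightarrow> real"
  assumes "bilinear b"
  shows "linear (form_endo b)" and "b e f = form_endo b e \<bullet> f"
proof -
  define B where "B e = (\<Sum>i\<in>Basis. b e i *\<^sub>R i)" for e
  have lin: "linear B"
    unfolding B_def by (intro linear_compose_sum ballI linearI)
      (simp_all add: bilinear_ladd[OF assms] bilinear_lmul[OF assms] scaleR_add_left)
  have B: "b e f = B e \<bullet> f" for e f
  proof -
    have "linear (b e)" using assms unfolding bilinear_def by blast
    then have "b e f = (\<Sum>i\<in>Basis. (f \<bullet> i) *\<^sub>R b e i)"
      by (metis (no_types, lifting) euclidean_representation linear_sum linear_scale sum.cong)
    then show ?thesis
      unfolding B_def by (simp add: inner_sum_left inner_commute[of f] mult.commute)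
  qed
  have "form_endo b = B"
    unfolding form_endo_def
  proof (rule the_equality)
    fix B' assume "linear B' \<and> (\<forall>e f. b e f = - neg_inner (B' e) f)"
    then have "B' e \<bullet> f = B e \<bullet> f" for e f unfolding neg_inner_def B by simp
    then show "B' = B" using vector_eq_rdot by blast
  qed (simp add: lin B neg_inner_def)
  with lin B show "linear (form_endo b)" "b e f = form_endo b e \<bullet> f" by simp_all
qed

lemma surj_form_endo:
  fixes b :: "'a::euclidean_space \<Rightarrow> 'a \<Rightarrow> real"
  assumes "bilinear b" "nondegenerate b"
  shows "surj (form_endo b)"
proof -
  have "e = 0" if "form_endo b e = 0" for e
    using assms(2) that unfolding nondegenerate_def by (simp add: form_endo[OF assms(1)])
  then have "inj (form_endo b)"
    using form_endo(1)[OF assms(1)] by (simp add: linear_injective_0)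
  then show ?thesis
    by (rule linear_inj_imp_surj[OF form_endo(1)[OF assms(1)]])
qed

locale heis_representation =
  fixes b :: "'a::euclidean_space \<Rightarrow> 'a \<Rightarrow> real"
    and \<rho> :: "'a heis \<Rightarrow> 's::real_vector \<times> 's \<Rightarrow> 's \<times> 's"
  assumes bil_b: "bilinear b"
    and rep: "lie_representation (heis_bracket b) \<rho>"
begin

definition rho22 :: "'a \<Rightarrow> 's \<Rightarrow> 's"
  where "rho22 e s = snd (\<rho> (0, e, 0) (0, s))"

lemma bilinear_rho: "bilinear \<rho>"
  using rep unfolding lie_representation_def by blast

lemmas rho_simps = bilinear_ladd[OF bilinear_rho] bilinear_radd[OF bilinear_rho]
  bilinear_lmul[OF bilinear_rho] bilinear_rmul[OF bilinear_rho] bilinear_rzero[OF bilinear_rho]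

lemma rho_bracket: "\<rho> (heis_bracket b x y) Q = \<rho> x (\<rho> y Q) - \<rho> y (\<rho> x Q)"
  using rep unfolding lie_representation_def by blast

lemma rho_vector_add: "\<rho> (0, e + f, 0) Q = \<rho> (0, e, 0) Q + \<rho> (0, f, 0) Q"
  and rho_vector_scale: "\<rho> (0, r *\<^sub>R e, 0) Q = r *\<^sub>R \<rho> (0, e, 0) Q"
  and rho_minus_add: "\<rho> h (s + t, 0) = \<rho> h (s, 0) + \<rho> h (t, 0)"
  and rho_minus_scale: "\<rho> h (r *\<^sub>R s, 0) = r *\<^sub>R \<rho> h (s, 0)"
  and rho_plus_add: "\<rho> h (0, s + t) = \<rho> h (0, s) + \<rho> h (0, t)"
  and rho_plus_scale: "\<rho> h (0, r *\<^sub>R s) = r *\<^sub>R \<rho> h (0, s)"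
  using rho_simps(1)[of "(0, e, 0)" "(0, f, 0)" Q] rho_simps(3)[of r "(0, e, 0)" Q]
    rho_simps(2)[of h "(s, 0)" "(t, 0)"] rho_simps(4)[of h r "(s, 0)"]
    rho_simps(2)[of h "(0, s)" "(0, t)"] rho_simps(4)[of h r "(0, s)"]
  by simp_all

lemmas rho_block_simps = rho_vector_add rho_vector_scale rho_minus_add rho_minus_scale
  rho_plus_add rho_plus_scale

lemma bilinear_rho11: "bilinear (rho11 \<rho>)"
  unfolding bilinear_def by (auto intro!: linearI simp: rho11_def rho_block_simps)

lemma bilinear_rho12: "bilinear (rho12 \<rho>)"
  unfolding bilinear_def by (auto intro!: linearI simp: rho12_def rho_block_simps)

lemma linear_rho22: "linear (rho22 e)"
  by (auto intro!: linearI simp: rho22_def rho_block_simps)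

lemma rho_vectors_commute: "\<rho> (0, e, 0) (\<rho> (0, f, 0) Q) = \<rho> (0, f, 0) (\<rho> (0, e, 0) Q)"
  using rho_bracket[of "(0, e, 0)" "(0, f, 0)" Q]
  unfolding heis_bracket_flat(3)[OF bil_b] bilinear_lzero[OF bilinear_rho] by simp

end

locale zero_charge_spin_representation =
  real_clifford_module c es + heis_representation b \<rho>
  for c :: "'a::euclidean_space \<Rightarrow> 's::real_vector \<Rightarrow> 's" and es :: "'a list"
    and b :: "'a \<Rightarrow> 'a \<Rightarrow> real" and \<rho> :: "'a heis \<Rightarrow> 's \<times> 's \<Rightarrow> 's \<times> 's" +
  assumes nondegenerate: "nondegenerate b"
    and spin: "spin_representation b c \<rho>"
    and charge: "zero_charge \<rho>"
begin

text \<open>Since \<open>B\<close> is onto, every Clifford multiplication arises from some \<open>\<rho>(e\<^sup>\<flat>)\<close>. These operators commute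
with \<open>\<rho>(E)\<close>, as the bracket \<open>[e\<^sup>\<flat>, f]\<close> is a multiple of the central element, which acts by zero.\<close>

lemma rho_dual:
  obtains \<alpha> where "\<And>Q. \<rho> (\<alpha>, 0, 0) Q = (sqrt 2 *\<^sub>R c v (snd Q), 0)"
    and "\<And>e Q. \<rho> (\<alpha>, 0, 0) (\<rho> (0, e, 0) Q) = \<rho> (0, e, 0) (\<rho> (\<alpha>, 0, 0) Q)"
proof -
  obtain u where u: "v = form_endo b u"
    using surj_form_endo[OF bil_b nondegenerate] by (rule surjE)
  show ?thesis
  proof (rule that[of "flat u"])
    show "\<rho> (flat u, 0, 0) Q = (sqrt 2 *\<^sub>R c v (snd Q), 0)" for Q
      using spin unfolding spin_representation_def upper_block_def u by simp
    fix e Q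
    have bracket: "heis_bracket b (flat u, 0, 0) (0, e, 0) = b u e *\<^sub>R heis_p"
      unfolding heis_bracket_flat(1)[OF bil_b] by (simp add: heis_p_def)
    have "\<rho> heis_p Q = 0" using charge unfolding zero_charge_def by blast
    then have "\<rho> (heis_bracket b (flat u, 0, 0) (0, e, 0)) Q = 0"
      unfolding bracket by (simp add: rho_simps)
    then show "\<rho> (flat u, 0, 0) (\<rho> (0, e, 0) Q) = \<rho> (0, e, 0) (\<rho> (flat u, 0, 0) Q)"
      unfolding rho_bracket by simp
  qed
qed

text \<open>The lower left block is annihilated by Clifford multiplication with a unit vector, which is
invertible.\<close>

lemma rho_vector_preserves_minus: "snd (\<rho> (0, e, 0) (s, 0)) = 0"
proof -
  obtain v :: 'a where v: "v \<in> Basis" using nonempty_Basis by blast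
  obtain \<alpha> where \<alpha>: "\<And>Q. \<rho> (\<alpha>, 0, 0) Q = (sqrt 2 *\<^sub>R c v (snd Q), 0)"
    "\<And>e Q. \<rho> (\<alpha>, 0, 0) (\<rho> (0, e, 0) Q) = \<rho> (0, e, 0) (\<rho> (\<alpha>, 0, 0) Q)"
    by (rule rho_dual[of v], rule that)
  have "sqrt 2 *\<^sub>R c v (snd (\<rho> (0, e, 0) (s, 0))) = 0"
    using \<alpha>(2)[of e "(s, 0)"] rho_simps(5) by (simp add: \<alpha>(1) c_simps zero_prod_def)
  then have "c v (c v (snd (\<rho> (0, e, 0) (s, 0)))) = 0" by (simp add: c_simps)
  then show ?thesis using v by (simp add: c_square)
qed

lemma rho_vector_blocks:
  "\<rho> (0, e, 0) (s, t) = (rho11 \<rho> e s + rho12 \<rho> e t, rho22 e t)"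
proof -
  have "\<rho> (0, e, 0) (s, t) = \<rho> (0, e, 0) (s, 0) + \<rho> (0, e, 0) (0, t)"
    using rho_simps(2)[of "(0, e, 0)" "(s, 0)" "(0, t)"] by simp
  then show ?thesis
    by (simp add: prod_eq_iff rho11_def rho12_def rho22_def rho_vector_preserves_minus)
qed

text \<open>Comparing the upper right blocks in the commutation of \<open>\<rho>(e)\<close> with the operators \<open>\<rho>(\<alpha>)\<close> of
\<open>rho_dual\<close> yields \<open>\<rho>\<^sub>1\<^sub>1(e) v = v \<rho>\<^sub>2\<^sub>2(e)\<close>.\<close>

lemma rho11_rho22:
  obtains x y where "rho11 \<rho> e = (\<lambda>s. x *\<^sub>R s + y *\<^sub>R J s)" "rho22 e = (\<lambda>s. x *\<^sub>R s - y *\<^sub>R J s)"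
proof -
  have "rho11 \<rho> e (c v s) = c v (rho22 e s)" for v s
  proof -
    obtain \<alpha> where \<alpha>: "\<And>Q. \<rho> (\<alpha>, 0, 0) Q = (sqrt 2 *\<^sub>R c v (snd Q), 0)"
      "\<And>e Q. \<rho> (\<alpha>, 0, 0) (\<rho> (0, e, 0) Q) = \<rho> (0, e, 0) (\<rho> (\<alpha>, 0, 0) Q)"
      by (rule rho_dual[of v], rule that)
    have "sqrt 2 *\<^sub>R c v (rho22 e s) = sqrt 2 *\<^sub>R rho11 \<rho> e (c v s)"
      using arg_cong[OF \<alpha>(2)[of e "(0, s)"], of fst]
      by (simp add: \<alpha>(1) rho22_def rho11_def rho_minus_scale)
    then show ?thesis by simp
  qed
  then obtain x y where "\<And>s. rho11 \<rho> e s = x *\<^sub>R s + y *\<^sub>R J s" "\<And>s. rho22 e s = x *\<^sub>R s - y *\<^sub>R J s"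
    using intertwining_pair[of "rho11 \<rho> e" "rho22 e"] bilinear_rho11 linear_rho22
    unfolding bilinear_def by metis
  then show ?thesis by (intro that) auto
qed

text \<open>With \<open>\<rho>\<^sub>2\<^sub>2\<close> the conjugate of \<open>\<rho>\<^sub>1\<^sub>1\<close>, the symmetry condition is the upper right block of
\<open>[\<rho>(e), \<rho>(f)] = 0\<close>. The operators \<open>\<rho>\<^sub>1\<^sub>1(e)\<close> commute because they are polynomials in \<open>J\<close>.\<close>

lemma suitable: "suitable_pair c J (rho11 \<rho>) (rho12 \<rho>)"
proof -
  have "rho11 \<rho> e (rho12 \<rho> f s) - rho12 \<rho> f (schur_conj J (rho11 \<rho> e) s) =
      rho11 \<rho> f (rho12 \<rho> e s) - rho12 \<rho> e (schur_conj J (rho11 \<rho> f) s)" for e f s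
  proof -
    have conj: "schur_conj J (rho11 \<rho> e) = rho22 e" for e
      by (rule rho11_rho22[of e]) (simp add: schur_conj_eq)
    have "rho11 \<rho> e (rho12 \<rho> f s) + rho12 \<rho> e (rho22 f s) =
        rho11 \<rho> f (rho12 \<rho> e s) + rho12 \<rho> f (rho22 e s)"
      using rho_vectors_commute[of e f "(0, s)"] bilinear_rzero[OF bilinear_rho11]
      by (simp add: rho_vector_blocks)
    then show ?thesis unfolding conj by (simp add: algebra_simps)
  qed
  moreover have "rho11 \<rho> e \<in> schur_algebra c" for e
    using rho11_rho22[of e] scalar_J_in_schur_algebra by metis
  moreover have "rho11 \<rho> e (rho11 \<rho> f s) - rho11 \<rho> f (rho11 \<rho> e s) = 0" for e f s
    by (rule rho11_rho22[of e], rule rho11_rho22[of f])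
      (simp add: linear_add[OF linear_J] linear_scale[OF linear_J] algebra_simps)
  ultimately show ?thesis
    unfolding suitable_pair_def using bilinear_rho11 bilinear_rho12 by blast
qed

end

section \<open>The invariant form of a superization\<close>

locale heis_superization =
  fixes b :: "'a::euclidean_space \<Rightarrow> 'a \<Rightarrow> real" and c :: "'a \<Rightarrow> 's::real_vector \<Rightarrow> 's"
    and br :: "'a heis \<times> ('s \<times> 's) \<Rightarrow> 'a heis \<times> ('s \<times> 's) \<Rightarrow> 'a heis \<times> ('s \<times> 's)"
  assumes bil: "bilinear b"
    and super: "superization b c br"
    and odd_span: "odd_bracket_span br = span {(heis_p, 0)}"
begin

lemma algebra: "lie_superalgebra super_grading br"
  using super unfolding superization_def by blast

lemma bilinear_br: "bilinear br"
  using algebra unfolding lie_superalgebra_def by blast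

lemma odd_bracket: "br (0, Q) (0, Q') = p_form br Q Q' *\<^sub>R (heis_p, 0)"
proof -
  have "br (0, Q) (0, Q') \<in> span {(heis_p, 0)}"
    unfolding odd_span[symmetric] odd_bracket_span_def by (rule span_base) blast
  then obtain r where r: "br (0, Q) (0, Q') = r *\<^sub>R (heis_p, 0)"
    unfolding span_singleton by blast
  moreover have "p_form br Q Q' = r"
    unfolding p_form_def r by (rule the_equality) (simp_all add: heis_p_def)
  ultimately show ?thesis by simp
qed

lemma p_form_eq: "p_form br Q Q' = snd (snd (fst (br (0, Q) (0, Q'))))"
  unfolding odd_bracket by (simp add: heis_p_def)

lemma bilinear_p_form: "bilinear (p_form br)"
proof -
  have "br (0, Q + P) R = br (0, Q) R + br (0, P) R" "br (0, r *\<^sub>R Q) R = r *\<^sub>R br (0, Q) R"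
    "br R (0, Q + P) = br R (0, Q) + br R (0, P)" "br R (0, r *\<^sub>R Q) = r *\<^sub>R br R (0, Q)" for Q P R r
    using bilinear_ladd[OF bilinear_br, of "(0, Q)" "(0, P)" R] bilinear_lmul[OF bilinear_br, of r "(0, Q)" R]
      bilinear_radd[OF bilinear_br, of R "(0, Q)" "(0, P)"] bilinear_rmul[OF bilinear_br, of R r "(0, Q)"]
    by simp_all
  then show ?thesis
    unfolding bilinear_def by (intro conjI allI linearI) (simp_all only: p_form_eq fst_add snd_add fst_scaleR snd_scaleR)
qed

lemma p_form_sym: "p_form br Q Q' = p_form br Q' Q"
proof -
  have "\<forall>i\<in>{0, 1}. \<forall>j\<in>{0, 1}. \<forall>x\<in>super_grading i. \<forall>y\<in>super_grading j.
      br x y = - ((- 1) ^ (i * j) *\<^sub>R br y x)"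
    using algebra unfolding lie_superalgebra_def by (elim conjE)
  from this[THEN bspec[of _ _ 1], THEN bspec[of _ _ 1], THEN bspec[of _ _ "(0, Q)"],
      THEN bspec[of _ _ "(0, Q')"]]
  have "br (0, Q) (0, Q') = br (0, Q') (0, Q)" by (simp add: super_grading_def)
  then show ?thesis unfolding p_form_eq by simp
qed

lemma even_odd_bracket: "br (h, 0) (0, Q) = (0, odd_adjoint br h Q)"
proof -
  have "\<forall>i\<in>{0, 1}. \<forall>j\<in>{0, 1}. \<forall>x\<in>super_grading i. \<forall>y\<in>super_grading j.
      br x y \<in> super_grading ((i + j) mod 2)"
    using algebra unfolding lie_superalgebra_def by (elim conjE)
  from this[THEN bspec[of _ _ 0], THEN bspec[of _ _ 1], THEN bspec[of _ _ "(h, 0)"],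
      THEN bspec[of _ _ "(0, Q)"]]
  have "br (h, 0) (0, Q) \<in> {0} \<times> UNIV" by (simp add: super_grading_def)
  then show ?thesis by (auto simp: odd_adjoint_def prod_eq_iff)
qed

text \<open>The Jacobi identity for one even and two odd elements, in which the bracket with the central element \<open>p\<close>
drops out.\<close>

lemma p_form_invariant:
  "p_form br (odd_adjoint br h Q) Q' + p_form br Q (odd_adjoint br h Q') = 0"
proof -
  have "\<forall>i\<in>{0, 1}. \<forall>j\<in>{0, 1}. \<forall>x\<in>super_grading i. \<forall>y\<in>super_grading j. \<forall>z.
      br x (br y z) = br (br x y) z + (- 1) ^ (i * j) *\<^sub>R br y (br x z)"
    using algebra unfolding lie_superalgebra_def by (elim conjE)
  from this[THEN bspec[of _ _ 0], THEN bspec[of _ _ 1], THEN bspec[of _ _ "(h, 0)"],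
      THEN bspec[of _ _ "(0, Q)"], THEN spec[of _ "(0, Q')"]]
  have jacobi: "br (h, 0) (br (0, Q) (0, Q')) =
      br (br (h, 0) (0, Q)) (0, Q') + br (0, Q) (br (h, 0) (0, Q'))"
    by (simp add: super_grading_def)
  have "br (h, 0) (heis_p, 0) = 0"
  proof -
    have "br (h, 0) (heis_p, 0) = (heis_bracket b h heis_p, 0)"
      using super unfolding superization_def by blast
    then show ?thesis unfolding heis_p_central[OF bil] zero_prod_def .
  qed
  then have "br (h, 0) (br (0, Q) (0, Q')) = 0"
    unfolding odd_bracket by (simp only: bilinear_rmul[OF bilinear_br] scaleR_zero_right)
  then have "br (0, odd_adjoint br h Q) (0, Q') + br (0, Q) (0, odd_adjoint br h Q') = 0"
    using jacobi by (simp only: even_odd_bracket)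
  then have "snd (snd (fst (br (0, odd_adjoint br h Q) (0, Q') + br (0, Q) (0, odd_adjoint br h Q')))) = 0"
    by simp
  then show ?thesis unfolding p_form_eq by simp
qed

lemma p_form_nonzero: "p_form br \<noteq> (\<lambda>Q Q'. 0)"
proof
  assume "p_form br = (\<lambda>Q Q'. 0)"
  then have "{br (0, Q) (0, Q') | Q Q'. True} \<subseteq> {0}" unfolding odd_bracket by (auto simp: zero_prod_def)
  then have "odd_bracket_span br \<subseteq> span {0}"
    unfolding odd_bracket_span_def by (rule span_mono)
  moreover have "(heis_p, 0) \<in> odd_bracket_span br"
    unfolding odd_span by (rule span_base) simp
  ultimately have "(heis_p :: 'a heis, 0 :: 's \<times> 's) = 0" by auto
  then show False by (simp add: heis_p_def zero_prod_def)
qed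

lemma p_form_blocks:
  "p_form br (s, t) (s', t') = p_mm br s s' + p_mp br s t' + p_mp br s' t + p_pp br t t'"
proof -
  have "p_form br (s, t) (s', t') = p_form br ((s, 0) + (0, t)) ((s', 0) + (0, t'))" by simp
  then show ?thesis
    unfolding bilinear_ladd[OF bilinear_p_form] bilinear_radd[OF bilinear_p_form]
      p_mm_def p_mp_def p_pp_def using p_form_sym[of "(0, t)" "(s', 0)"] by simp
qed

lemma p_form_block_linear:
  "p_form br (s + s', 0) Q = p_form br (s, 0) Q + p_form br (s', 0) Q"
  "p_form br (0, s + s') Q = p_form br (0, s) Q + p_form br (0, s') Q"
  "p_form br (r *\<^sub>R s, 0) Q = r * p_form br (s, 0) Q"
  "p_form br (0, r *\<^sub>R s) Q = r * p_form br (0, s) Q"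
  using bilinear_ladd[OF bilinear_p_form, of "(s, 0)" "(s', 0)" Q]
    bilinear_ladd[OF bilinear_p_form, of "(0, s)" "(0, s')" Q]
    bilinear_lmul[OF bilinear_p_form, of r "(s, 0)" Q]
    bilinear_lmul[OF bilinear_p_form, of r "(0, s)" Q] by simp_all

lemma bilinear_p_blocks: "bilinear (p_mp br)" "bilinear (p_pp br)"
proof -
  have "p_form br Q (0, s + s') = p_form br Q (0, s) + p_form br Q (0, s')"
    "p_form br Q (0, r *\<^sub>R s) = r * p_form br Q (0, s)" for Q s s' r
    using p_form_block_linear(2)[of s s' Q] p_form_block_linear(4)[of r s Q]
    by (simp_all only: p_form_sym[of Q])
  then show "bilinear (p_mp br)" "bilinear (p_pp br)"
    unfolding bilinear_def p_mp_def p_pp_def by (auto intro!: linearI simp: p_form_block_linear)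
qed

end

section \<open>The structure of zero charge superizations\<close>

theorem proposition3p3:
  fixes b :: "'a::euclidean_space \<Rightarrow> 'a \<Rightarrow> real"
    and c :: "'a \<Rightarrow> 's::real_vector \<Rightarrow> 's"
    and cm :: "'a \<times> real \<times> real \<Rightarrow> 's \<times> 's \<Rightarrow> 's \<times> 's"
    and es :: "'a list"
    and J :: "'s \<Rightarrow> 's"
    and br :: "'a heis \<times> ('s \<times> 's) \<Rightarrow> 'a heis \<times> ('s \<times> 's) \<Rightarrow> 'a heis \<times> ('s \<times> 's)"
    and \<rho> :: "'a heis \<Rightarrow> 's \<times> 's \<Rightarrow> 's \<times> 's"
  assumes dim: "DIM('a) mod 8 = 2"
    and b: "bilinear b" "\<And>e f. b e f = b f e" "nondegenerate b"
    and c: "irreducible_clifford_module neg_inner c"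
    and J: "orthonormal_frame es" "J = volume_action c es"
    and cm: "mink_spinor_module c cm"
    and br: "zero_charge_superization b c br"
    and SS: "odd_bracket_span br = span {(heis_p, 0)}"
    and \<rho>: "\<rho> = odd_adjoint br"
  shows "p_mm br = (\<lambda>s t. 0) \<and> p_mp br = (\<lambda>s t. 0) \<and> p_pp br \<noteq> (\<lambda>s t. 0) \<and>
    suitable_pair c J (rho11 \<rho>) (rho12 \<rho>) \<and>
    (rho11 \<rho> = (\<lambda>e s. 0) \<or>
     rho11 \<rho> \<noteq> (\<lambda>e s. 0) \<and> (\<forall>e. \<exists>r. rho11 \<rho> e = (\<lambda>s. r *\<^sub>R J s)) \<and>
       J_hermitian J (p_pp br))"
proof -
  have spin: "spin_representation b c \<rho>" and charge: "zero_charge \<rho>" and super: "superization b c br"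
    using br unfolding zero_charge_superization_def superization_def \<rho> by blast+
  interpret heis_superization b c br
    by (rule heis_superization.intro[OF b(1) super SS])
  interpret zero_charge_spin_representation c es b \<rho>
  proof
    show "clifford_module neg_inner c"
      using c unfolding irreducible_clifford_module_def by blast
    show "lie_representation (heis_bracket b) \<rho>"
      using spin unfolding spin_representation_def by blast
  qed (fact c dim J(1) b(1,3) spin charge)+
  have Jeq: "J_hermitian J = J_hermitian local.J" "J = local.J"
    unfolding J(2) J_def by simp_all
  note invariant = p_form_invariant[folded \<rho>]
  note p_form_zero = bilinear_rzero[OF bilinear_p_form]
  have mm: "p_mm br s t = 0" for s t
  proof -
    obtain v :: 'a where v: "v \<in> Basis" using nonempty_Basis by blast
    obtain \<alpha> where \<alpha>: "\<And>Q. \<rho> (\<alpha>, 0, 0) Q = (sqrt 2 *\<^sub>R c v (snd Q), 0)"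
      by (rule rho_dual[of v], rule that)
    \<comment> \<open>Every \<open>s\<close> is the Clifford product of the unit vector \<open>v\<close> with \<open>v s\<close>, and \<open>\<rho>(\<alpha>)\<close> kills \<open>S\<^sub>-\<close>.\<close>
    have "p_form br (sqrt 2 *\<^sub>R s, 0) (t, 0) = 0"
      using invariant[of "(\<alpha>, 0, 0)" "(0, c v s)" "(t, 0)"] v p_form_zero
      by (simp add: \<alpha> c_square c_simps zero_prod_def)
    then show ?thesis by (simp add: p_mm_def p_form_block_linear)
  qed
  have mp: "p_mp br s t = 0" for s t
  proof (rule exchange_skew_form_zero[OF bilinear_p_blocks(1)])
    fix v s t
    obtain \<alpha> where \<alpha>: "\<And>Q. \<rho> (\<alpha>, 0, 0) Q = (sqrt 2 *\<^sub>R c v (snd Q), 0)"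
      by (rule rho_dual[of v], rule that)
    have "p_form br (sqrt 2 *\<^sub>R c v s, 0) (0, t) + p_form br (sqrt 2 *\<^sub>R c v t, 0) (0, s) = 0"
      using invariant[of "(\<alpha>, 0, 0)" "(0, s)" "(0, t)"]
      by (simp add: \<alpha> p_form_sym[of "(0, s)"])
    then have "sqrt 2 * (p_mp br (c v s) t + p_mp br (c v t) s) = 0"
      unfolding p_mp_def p_form_block_linear by (simp add: distrib_left)
    then show "p_mp br (c v s) t = - p_mp br (c v t) s" by (simp add: eq_neg_iff_add_eq_0)
  qed
  \<comment> \<open>The form is thus pulled back from \<open>S\<^sub>+\<close>, where \<open>\<rho>(e)\<close> acts by its lower right block.\<close>
  have pp: "p_form br Q Q' = p_pp br (snd Q) (snd Q')" for Q Q'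
    using p_form_blocks[of "fst Q" "snd Q" "fst Q'" "snd Q'"] by (simp add: mm mp)
  obtain s0 t0 where pp_nonzero: "p_pp br s0 t0 \<noteq> 0"
    using p_form_nonzero unfolding pp fun_eq_iff by blast
  have r11: "\<exists>y. rho11 \<rho> e = (\<lambda>s. y *\<^sub>R J s) \<and> (y \<noteq> 0 \<longrightarrow> J_hermitian J (p_pp br))" for e
  proof -
    obtain x y where xy: "rho11 \<rho> e = (\<lambda>s. x *\<^sub>R s + y *\<^sub>R local.J s)"
      "rho22 e = (\<lambda>s. x *\<^sub>R s - y *\<^sub>R local.J s)"
      by (rule rho11_rho22)
    have "p_pp br (rho22 e s) t + p_pp br s (rho22 e t) = 0" for s t
      using invariant[of "(0, e, 0)" "(0, s)" "(0, t)"] by (simp add: pp rho_vector_blocks)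
    then have "x = 0" "y \<noteq> 0 \<Longrightarrow> J_hermitian J (p_pp br)"
      using invariant_form_hermitian[OF bilinear_p_blocks(2) pp_nonzero, of x y] unfolding xy(2) Jeq(1)
      by blast+
    then show ?thesis using xy(1) unfolding Jeq(2) by auto
  qed
  have "J_hermitian J (p_pp br)" if nonzero: "rho11 \<rho> \<noteq> (\<lambda>e s. 0)"
  proof -
    obtain e where e: "rho11 \<rho> e \<noteq> (\<lambda>s. 0)" using nonzero by blast
    obtain y where "rho11 \<rho> e = (\<lambda>s. y *\<^sub>R J s)" "y \<noteq> 0 \<longrightarrow> J_hermitian J (p_pp br)"
      using r11[of e] by blast
    then show ?thesis using e by (cases "y = 0") simp_all
  qed
  moreover have "p_pp br \<noteq> (\<lambda>s t. 0)" using pp_nonzero by metis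
  moreover have "suitable_pair c J (rho11 \<rho>) (rho12 \<rho>)" using suitable unfolding Jeq(2) .
  moreover have "p_mm br = (\<lambda>s t. 0)" "p_mp br = (\<lambda>s t. 0)" by (simp_all add: fun_eq_iff mm mp)
  ultimately show ?thesis using r11 by blast
qed

end
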